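(* Let $R$ be a commutative ring, $B$ a commutative $R$-algebra, $n\geq 1$ an integer, and let $\Omega^1=\Omega^1_{B/R}$. The $B$-linear map $$\lambda:\ (\Omega^1)^{\otimes n}\longrightarrow \bigcap_{0\le r<s\le n}\tilde J_{rs}\ \subset\ B^{\otimes n+1}/J^{(2)}_{0n},\qquad \lambda(db_1\otimes\cdots\otimes db_n)=\prod_{i=1}^n d^{0,i}b_i \ \bmod J^{(2)}_{0n},$$ is surjective. Here $(\Omega^1)^{\otimes n}$ is the tensor power over $B$, and $B^{\otimes n+1}$ is the tensor power over $R$.
   Context: Let $J=\ker(B\otimes_R B\to B)$ be the kernel of multiplication; $\Omega^1=J/J^2$, with $db$ the class of $1\otimes b-b\otimes 1$. For $0\le r,s\le n$ and $b\in B$, set $d^{r,s}b:=(1\otimes\cdots\otimes b\otimes\cdots\otimes 1)-(1\otimes\cdots\otimes b\otimes\cdots\otimes 1)\in B^{\otimes n+1}$, where $b$ is placed in position $s+1$ in the first tensor and in position $r+1$ in the second. $J_{rs}$ is the ideal of $B^{\otimes n+1}$ generated by all $d^{r,s}b$, $b\in B$, and $J^{(2)}_{0n}:=\sum_{0\le r<s\le n}J_{rs}^2$. $\tilde J_{rs}$ is the image of $J_{rs}$ in $B^{\otimes n+1}/J^{(2)}_{0n}$. The ring $B^{\otimes n+1}/J^{(2)}_{0n}$ is a $B$-algebra via $b\mapsto b\otimes 1\otimes\cdots\otimes 1$. The map $\lambda$ is the composite of the isomorphism $(\Omega^1)^{\otimes n}\simeq\prod_{i=1}^n J_{0i}$ (product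 of ideals in $B^{\otimes n+1}/\sum_{i=1}^n J_{0i}^2$), the projection onto the ideal $\prod_{i=1}^n\tilde J_{0i}$ of $B^{\otimes n+1}/J^{(2)}_{0n}$, and the inclusion $\prod_{i=1}^n\tilde J_{0i}\subset\bigcap_{r<s}\tilde J_{rs}$. *)

theory Defs
  imports "HOL-Algebra.Module" "HOL-Algebra.Ideal_Product" "HOL-Algebra.Product_Groups" "HOL-Algebra.QuotRing"
begin

section \<open>Free modules, quotient modules and tensor powers\<close>

text \<open>The record type of modules extends that of rings. The fields \<open>mult\<close> and \<open>one\<close> play no role
  for a module and are left \<open>undefined\<close> here.\<close>

definition free_module :: "('r, 's) ring_scheme \<Rightarrow> 'x set \<Rightarrow> ('r, 'x \<Rightarrow> 'r) module"
  where "free_module R X =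
    \<lparr>carrier = {f. range f \<subseteq> carrier R \<and> finite {x. f x \<noteq> \<zero>\<^bsub>R\<^esub>} \<and> {x. f x \<noteq> \<zero>\<^bsub>R\<^esub>} \<subseteq> X},
     mult = undefined, one = undefined,
     zero = (\<lambda>_. \<zero>\<^bsub>R\<^esub>), add = (\<lambda>f g x. f x \<oplus>\<^bsub>R\<^esub> g x),
     smult = (\<lambda>a f x. a \<otimes>\<^bsub>R\<^esub> f x)\<rparr>"

definition basis_elem :: "('r, 's) ring_scheme \<Rightarrow> 'x \<Rightarrow> 'x \<Rightarrow> 'r"
  where "basis_elem R x = (\<lambda>y. if y = x then \<one>\<^bsub>R\<^esub> else \<zero>\<^bsub>R\<^esub>)"

definition submodule_span ::
    "('r, 's) ring_scheme \<Rightarrow> ('r, 'm, 't) module_scheme \<Rightarrow> 'm set \<Rightarrow> 'm set"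
  where "submodule_span R M S = \<Inter>{N. submodule N R M \<and> S \<subseteq> N}"

definition quot_module :: "('r, 'm, 't) module_scheme \<Rightarrow> 'm set \<Rightarrow> ('r, 'm set) module"
  where "quot_module M N =
    \<lparr>carrier = a_rcosets\<^bsub>M\<^esub> N,
     mult = undefined, one = undefined,
     zero = N, add = set_add M,
     smult = (\<lambda>a X. \<Union>x\<in>X. N +>\<^bsub>M\<^esub> (a \<odot>\<^bsub>M\<^esub> x))\<rparr>"

definition linear_map ::
    "('r, 's) ring_scheme \<Rightarrow> ('r, 'm, 't) module_scheme \<Rightarrow> ('r, 'n, 'u) module_scheme
      \<Rightarrow> ('m \<Rightarrow> 'n) \<Rightarrow> bool"
  where "linear_map R M N h \<longleftrightarrow>
    h \<in> carrier M \<rightarrow> carrier N \<and>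
    (\<forall>x\<in>carrier M. \<forall>y\<in>carrier M. h (x \<oplus>\<^bsub>M\<^esub> y) = h x \<oplus>\<^bsub>N\<^esub> h y) \<and>
    (\<forall>a\<in>carrier R. \<forall>x\<in>carrier M. h (a \<odot>\<^bsub>M\<^esub> x) = a \<odot>\<^bsub>N\<^esub> h x)"

text \<open>The tensor power of the \<open>R\<close>-module \<open>M\<close> with factors indexed by \<open>I\<close> is the free \<open>R\<close>-module on
  all families \<open>x \<in> M\<^sup>I\<close>, modulo the submodule generated by the multilinearity relations.\<close>

abbreviation tensor_free ::
    "('r, 's) ring_scheme \<Rightarrow> ('r, 'm, 't) module_scheme \<Rightarrow> 'i set \<Rightarrow> ('r, ('i \<Rightarrow> 'm) \<Rightarrow> 'r) module"
  where "tensor_free R M I \<equiv> free_module R (I \<rightarrow>\<^sub>E carrier M)"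

definition tensor_rel ::
    "('r, 's) ring_scheme \<Rightarrow> ('r, 'm, 't) module_scheme \<Rightarrow> 'i set \<Rightarrow> (('i \<Rightarrow> 'm) \<Rightarrow> 'r) set"
  where "tensor_rel R M I = submodule_span R (tensor_free R M I)
    ({basis_elem R (x(i := a \<oplus>\<^bsub>M\<^esub> b))
        \<ominus>\<^bsub>tensor_free R M I\<^esub> (basis_elem R (x(i := a)) \<oplus>\<^bsub>tensor_free R M I\<^esub> basis_elem R (x(i := b)))
      | x i a b. x \<in> I \<rightarrow>\<^sub>E carrier M \<and> i \<in> I \<and> a \<in> carrier M \<and> b \<in> carrier M} \<union>
     {basis_elem R (x(i := c \<odot>\<^bsub>M\<^esub> a))
        \<ominus>\<^bsub>tensor_free R M I\<^esub> (c \<odot>\<^bsub>tensor_free R M I\<^esub> basis_elem R (x(i := a)))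
      | x i a c. x \<in> I \<rightarrow>\<^sub>E carrier M \<and> i \<in> I \<and> a \<in> carrier M \<and> c \<in> carrier R})"

definition tensor_power ::
    "('r, 's) ring_scheme \<Rightarrow> ('r, 'm, 't) module_scheme \<Rightarrow> 'i set
      \<Rightarrow> ('r, (('i \<Rightarrow> 'm) \<Rightarrow> 'r) set) module"
  where "tensor_power R M I = quot_module (tensor_free R M I) (tensor_rel R M I)"

definition pure_tensor ::
    "('r, 's) ring_scheme \<Rightarrow> ('r, 'm, 't) module_scheme \<Rightarrow> 'i set \<Rightarrow> ('i \<Rightarrow> 'm)
      \<Rightarrow> (('i \<Rightarrow> 'm) \<Rightarrow> 'r) set"
  where "pure_tensor R M I x = tensor_rel R M I +>\<^bsub>tensor_free R M I\<^esub> basis_elem R x"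


section \<open>Tensor powers of algebras\<close>

definition monoid_algebra ::
    "('r, 's) ring_scheme \<Rightarrow> ('x, 't) monoid_scheme \<Rightarrow> ('r, 'x \<Rightarrow> 'r) module"
  where "monoid_algebra R G = (free_module R (carrier G))
    \<lparr>mult := (\<lambda>f g z. \<Oplus>\<^bsub>R\<^esub>p\<in>{(x, y). f x \<noteq> \<zero>\<^bsub>R\<^esub> \<and> g y \<noteq> \<zero>\<^bsub>R\<^esub> \<and> x \<otimes>\<^bsub>G\<^esub> y = z}. f (fst p) \<otimes>\<^bsub>R\<^esub> g (snd p)),
     one := basis_elem R \<one>\<^bsub>G\<^esub>\<rparr>"

text \<open>The ring \<open>B\<^sup>\<otimes>\<^sup>n\<^sup>+\<^sup>1\<close>, its factors indexed by \<open>0, \<dots>, n\<close> (index \<open>i\<close> is position \<open>i + 1\<close>). It has the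
  same underlying additive group as \<open>tensor_power R B {..n}\<close>; the multiplication is the one with
  \<open>(\<Otimes>x\<^sub>i) (\<Otimes>y\<^sub>i) = \<Otimes>(x\<^sub>i y\<^sub>i)\<close>, which comes from the monoid algebra of the multiplicative monoid
  \<open>B\<^sup>n\<^sup>+\<^sup>1\<close>, where the submodule of multilinearity relations is an ideal.\<close>

definition tensor_ring ::
    "('r, 's) ring_scheme \<Rightarrow> ('r, 'b, 't) module_scheme \<Rightarrow> nat \<Rightarrow> ((nat \<Rightarrow> 'b) \<Rightarrow> 'r) set ring"
  where "tensor_ring R B n = monoid_algebra R (product_group {..n} (\<lambda>_. B)) Quot tensor_rel R B {..n}"

definition place ::
    "('r, 's) ring_scheme \<Rightarrow> ('r, 'b, 't) module_scheme \<Rightarrow> nat \<Rightarrow> nat \<Rightarrow> 'b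
      \<Rightarrow> ((nat \<Rightarrow> 'b) \<Rightarrow> 'r) set"
  where "place R B n i b = pure_tensor R B {..n} (\<lambda>j\<in>{..n}. if j = i then b else \<one>\<^bsub>B\<^esub>)"

definition dtensor ::
    "('r, 's) ring_scheme \<Rightarrow> ('r, 'b, 't) module_scheme \<Rightarrow> nat \<Rightarrow> nat \<Rightarrow> nat \<Rightarrow> 'b
      \<Rightarrow> ((nat \<Rightarrow> 'b) \<Rightarrow> 'r) set"
  where "dtensor R B n r s b = place R B n s b \<ominus>\<^bsub>tensor_ring R B n\<^esub> place R B n r b"

definition restrict_scalars :: "('b \<Rightarrow> 'a) \<Rightarrow> ('a, 's) ring_scheme \<Rightarrow> ('b, 'a) module"
  where "restrict_scalars h S =
    \<lparr>carrier = carrier S, mult = mult S, one = \<one>\<^bsub>S\<^esub>, zero = \<zero>\<^bsub>S\<^esub>, add = add S,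
     smult = (\<lambda>b x. h b \<otimes>\<^bsub>S\<^esub> x)\<rparr>"


section \<open>Kaehler differentials\<close>

text \<open>The map \<open>B \<otimes> B \<rightarrow> B\<close>, \<open>x \<otimes> y \<mapsto> x y\<close>. A class \<open>X\<close> goes to the common value at all its
  representatives of the linear extension of \<open>x \<mapsto> x 0 \<cdot> x 1\<close> to the free module.\<close>

definition mult_map ::
    "('r, 's) ring_scheme \<Rightarrow> ('r, 'b, 't) module_scheme \<Rightarrow> ((nat \<Rightarrow> 'b) \<Rightarrow> 'r) set \<Rightarrow> 'b"
  where "mult_map R B X =
    the_elem ((\<lambda>f. \<Oplus>\<^bsub>B\<^esub>x\<in>{x. f x \<noteq> \<zero>\<^bsub>R\<^esub>}. f x \<odot>\<^bsub>B\<^esub> (x 0 \<otimes>\<^bsub>B\<^esub> x 1)) ` X)"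

definition diag_ideal ::
    "('r, 's) ring_scheme \<Rightarrow> ('r, 'b, 't) module_scheme \<Rightarrow> ((nat \<Rightarrow> 'b) \<Rightarrow> 'r) set set"
  where "diag_ideal R B = a_kernel (tensor_ring R B 1) B (mult_map R B)"

definition diag_ideal_sq ::
    "('r, 's) ring_scheme \<Rightarrow> ('r, 'b, 't) module_scheme \<Rightarrow> ((nat \<Rightarrow> 'b) \<Rightarrow> 'r) set set"
  where "diag_ideal_sq R B = diag_ideal R B \<cdot>\<^bsub>tensor_ring R B 1\<^esub> diag_ideal R B"

text \<open>\<open>\<Omega>\<^sup>1 = J / J\<^sup>2\<close> is the image of \<open>J\<close> in \<open>(B \<otimes> B) / J\<^sup>2\<close>. The scalar \<open>b\<close> acts as \<open>b \<otimes> 1\<close>, which on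
  \<open>J / J\<^sup>2\<close> is the same as acting as \<open>1 \<otimes> b\<close>.\<close>

definition Omega1 ::
    "('r, 's) ring_scheme \<Rightarrow> ('r, 'b, 't) module_scheme \<Rightarrow> ('b, ((nat \<Rightarrow> 'b) \<Rightarrow> 'r) set set) module"
  where "Omega1 R B =
    (restrict_scalars (\<lambda>b. diag_ideal_sq R B +>\<^bsub>tensor_ring R B 1\<^esub> place R B 1 0 b)
      (tensor_ring R B 1 Quot diag_ideal_sq R B))
    \<lparr>carrier := (\<lambda>x. diag_ideal_sq R B +>\<^bsub>tensor_ring R B 1\<^esub> x) ` diag_ideal R B\<rparr>"

definition univ_deriv ::
    "('r, 's) ring_scheme \<Rightarrow> ('r, 'b, 't) module_scheme \<Rightarrow> 'b \<Rightarrow> ((nat \<Rightarrow> 'b) \<Rightarrow> 'r) set set"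
  where "univ_deriv R B b = diag_ideal_sq R B +>\<^bsub>tensor_ring R B 1\<^esub>
    (place R B 1 1 b \<ominus>\<^bsub>tensor_ring R B 1\<^esub> place R B 1 0 b)"

abbreviation Omega_power ::
    "('r, 's) ring_scheme \<Rightarrow> ('r, 'b, 't) module_scheme \<Rightarrow> nat
      \<Rightarrow> ('b, ((nat \<Rightarrow> ((nat \<Rightarrow> 'b) \<Rightarrow> 'r) set set) \<Rightarrow> 'b) set) module"
  where "Omega_power R B n \<equiv> tensor_power B (Omega1 R B) {1..n}"


section \<open>The ideals \<open>J\<^sub>r\<^sub>s\<close> and the map \<open>\<lambda>\<close>\<close>

definition Jrs ::
    "('r, 's) ring_scheme \<Rightarrow> ('r, 'b, 't) module_scheme \<Rightarrow> nat \<Rightarrow> nat \<Rightarrow> nat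
      \<Rightarrow> ((nat \<Rightarrow> 'b) \<Rightarrow> 'r) set set"
  where "Jrs R B n r s = Idl\<^bsub>tensor_ring R B n\<^esub> (dtensor R B n r s ` carrier B)"

definition J2 ::
    "('r, 's) ring_scheme \<Rightarrow> ('r, 'b, 't) module_scheme \<Rightarrow> nat \<Rightarrow> ((nat \<Rightarrow> 'b) \<Rightarrow> 'r) set set"
  where "J2 R B n = (\<Oplus>\<^bsub>ideals_set (tensor_ring R B n)\<^esub>p\<in>{(r, s). r < s \<and> s \<le> n}.
    Jrs R B n (fst p) (snd p) \<cdot>\<^bsub>tensor_ring R B n\<^esub> Jrs R B n (fst p) (snd p))"

definition Jtilde ::
    "('r, 's) ring_scheme \<Rightarrow> ('r, 'b, 't) module_scheme \<Rightarrow> nat \<Rightarrow> nat \<Rightarrow> nat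
      \<Rightarrow> ((nat \<Rightarrow> 'b) \<Rightarrow> 'r) set set set"
  where "Jtilde R B n r s = (\<lambda>x. J2 R B n +>\<^bsub>tensor_ring R B n\<^esub> x) ` Jrs R B n r s"

text \<open>\<open>B\<^sup>\<otimes>\<^sup>n\<^sup>+\<^sup>1 / J\<^sup>(\<^sup>2\<^sup>)\<close> as a \<open>B\<close>-module via \<open>b \<mapsto> b \<otimes> 1 \<otimes> \<dots> \<otimes> 1\<close>.\<close>

definition tensor_quot ::
    "('r, 's) ring_scheme \<Rightarrow> ('r, 'b, 't) module_scheme \<Rightarrow> nat
      \<Rightarrow> ('b, ((nat \<Rightarrow> 'b) \<Rightarrow> 'r) set set) module"
  where "tensor_quot R B n =
    restrict_scalars (\<lambda>b. J2 R B n +>\<^bsub>tensor_ring R B n\<^esub> place R B n 0 b)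
      (tensor_ring R B n Quot J2 R B n)"

text \<open>The tensors \<open>db\<^sub>1 \<otimes> \<dots> \<otimes> db\<^sub>n\<close> generate the tensor power over \<open>B\<close>, so linearity and the formula
  determine \<open>\<lambda>\<close>; \<open>extensional\<close> only fixes the irrelevant values off the carrier, so that \<open>\<lambda>\<close> is unique as a HOL
  function.\<close>

definition is_lambda ::
    "('r, 's) ring_scheme \<Rightarrow> ('r, 'b, 't) module_scheme \<Rightarrow> nat
      \<Rightarrow> (((nat \<Rightarrow> ((nat \<Rightarrow> 'b) \<Rightarrow> 'r) set set) \<Rightarrow> 'b) set \<Rightarrow> ((nat \<Rightarrow> 'b) \<Rightarrow> 'r) set set) \<Rightarrow> bool"
  where "is_lambda R B n l \<longleftrightarrow>
    l \<in> extensional (carrier (Omega_power R B n)) \<and>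
    linear_map B (Omega_power R B n) (tensor_quot R B n) l \<and>
    (\<forall>b\<in>{1..n} \<rightarrow> carrier B.
      l (pure_tensor B (Omega1 R B) {1..n} (\<lambda>i\<in>{1..n}. univ_deriv R B (b i))) =
      J2 R B n +>\<^bsub>tensor_ring R B n\<^esub> (\<Otimes>\<^bsub>tensor_ring R B n\<^esub>i\<in>{1..n}. dtensor R B n 0 i (b i)))"

end

theory Submission
  imports Defs
begin

text \<open>
  Write \<open>T = B\<^sup>\<otimes>\<^sup>n\<^sup>+\<^sup>1\<close> and let \<open>p i b\<close> be the tensor with \<open>b\<close> at index \<open>i\<close> and \<open>1\<close> elsewhere, so that
  \<open>d r s b = p s b - p r b\<close>. The image of \<open>\<lambda>\<close> is computed by means of the ring endomorphisms
  \<open>\<sigma>\<^sub>i\<close> of \<open>T\<close> (\<open>1 \<le> i \<le> n\<close>; the functions \<open>collapse i\<close> below) that move the entry at index \<open>i\<close> to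
  index \<open>0\<close>, that is \<open>p i b \<mapsto> p 0 b\<close>, and fix \<open>p j b\<close> for \<open>j \<noteq> i\<close>. Each \<open>\<sigma>\<^sub>i\<close> maps \<open>J\<^sub>r\<^sub>s\<close> into one of
  these ideals or to zero; hence it preserves \<open>J\<^sup>(\<^sup>2\<^sup>)\<close>, and it kills \<open>J\<^sub>0\<^sub>i\<close>.

  If the class of \<open>x\<close> modulo \<open>J\<^sup>(\<^sup>2\<^sup>)\<close> lies in the image of \<open>J\<^sub>0\<^sub>i\<close> for all \<open>i\<close>, then \<open>\<sigma>\<^sub>i x \<in> J\<^sup>(\<^sup>2\<^sup>)\<close> for
  all \<open>i\<close>, so \<open>x\<close> is congruent to \<open>(1 - \<sigma>\<^sub>n) \<dots> (1 - \<sigma>\<^sub>1) x\<close> (lemma \<open>reduce_congruent\<close>). On a pure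
  tensor, a product of the \<open>p i (b i)\<close>, this operator gives \<open>p 0 (b 0)\<close> times the product of the
  \<open>d 0 i (b i)\<close> (lemma \<open>reduce_pure\<close>), which is the value of \<open>\<lambda>\<close> at \<open>b 0\<close> times
  \<open>db\<^sub>1 \<otimes> \<dots> \<otimes> db\<^sub>n\<close>. As the pure tensors generate \<open>T\<close> additively, the class of \<open>x\<close> is in the image of
  \<open>\<lambda>\<close>. So the intersection of the images of \<open>J\<^sub>0\<^sub>1, \<dots>, J\<^sub>0\<^sub>n\<close> alone is contained in the image of \<open>\<lambda>\<close>.
  Conversely the image of \<open>\<lambda>\<close> is contained in the image of every \<open>J\<^sub>r\<^sub>s\<close>, because for \<open>0 < r < s\<close>
  \<open>d 0 r b \<cdot> d 0 s c = d 0 r b \<cdot> d 0 r c + d 0 r b \<cdot> d r s c\<close> lies in \<open>J\<^sub>0\<^sub>r\<^sup>2 + J\<^sub>r\<^sub>s\<close>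
  (lemma \<open>prod_in_J_plus_JJ\<close>).

  For the existence of \<open>\<lambda>\<close>, the ring map \<open>B \<otimes> B \<rightarrow> T\<close>, \<open>a \<otimes> b \<mapsto> p 0 a \<cdot> p i b\<close>, takes the kernel of
  multiplication into \<open>J\<^sub>0\<^sub>i\<close> and its square into \<open>J\<^sup>(\<^sup>2\<^sup>)\<close>. It thus induces a \<open>B\<close>-linear map from \<open>\<Omega>\<^sup>1\<close>
  to \<open>T/J\<^sup>(\<^sup>2\<^sup>)\<close> (lemma \<open>Omega_to_quot\<close>), and the product of these maps over \<open>i = 1, \<dots>, n\<close> is
  multilinear. Uniqueness holds because the tensors \<open>db\<^sub>1 \<otimes> \<dots> \<otimes> db\<^sub>n\<close> generate the tensor power
  (lemma \<open>Omega_power_induct\<close>).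

  Both arguments rest on the universal properties of the tensor power as a module
  (\<open>tensor_lift_linear\<close>) and of \<open>T\<close> as a ring (\<open>tensor_ring_universal\<close>). The latter needs that the
  monoid algebra of a commutative monoid is a commutative ring and that the multilinearity relations
  form an ideal of it.\<close>

section \<open>Free modules and linear extension\<close>

lemma free_module_carrier:
  "carrier (free_module R X) =
    {f. range f \<subseteq> carrier R \<and> finite {x. f x \<noteq> \<zero>\<^bsub>R\<^esub>} \<and> {x. f x \<noteq> \<zero>\<^bsub>R\<^esub>} \<subseteq> X}"
  by (simp add: free_module_def)

lemma free_module_ops [simp]:
  "\<zero>\<^bsub>free_module R X\<^esub> = (\<lambda>_. \<zero>\<^bsub>R\<^esub>)"
  "f \<oplus>\<^bsub>free_module R X\<^esub> g = (\<lambda>x. f x \<oplus>\<^bsub>R\<^esub> g x)"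
  "a \<odot>\<^bsub>free_module R X\<^esub> f = (\<lambda>x. a \<otimes>\<^bsub>R\<^esub> f x)"
  by (simp_all add: free_module_def)

lemma free_module_carrierD:
  assumes "f \<in> carrier (free_module R X)"
  shows "f x \<in> carrier R" and "finite {x. f x \<noteq> \<zero>\<^bsub>R\<^esub>}" and "{x. f x \<noteq> \<zero>\<^bsub>R\<^esub>} \<subseteq> X"
  using assms by (auto simp: free_module_carrier)

lemma (in cring) free_module_carrierI:
  assumes "\<And>x. f x \<in> carrier R" "finite S" "S \<subseteq> X" "\<And>x. x \<notin> S \<Longrightarrow> f x = \<zero>"
  shows "f \<in> carrier (free_module R X)"
proof -
  have "{x. f x \<noteq> \<zero>} \<subseteq> S" using assms(4) by auto
  then show ?thesis using assms by (auto simp: free_module_carrier intro: finite_subset)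
qed

lemma (in cring) free_module_is_module: "module R (free_module R X)"
proof (rule moduleI)
  have add_closed: "f \<oplus>\<^bsub>free_module R X\<^esub> g \<in> carrier (free_module R X)"
    if "f \<in> carrier (free_module R X)" "g \<in> carrier (free_module R X)" for f g
    by (rule free_module_carrierI[where S = "{x. f x \<noteq> \<zero>} \<union> {x. g x \<noteq> \<zero>}"])
      (use that[THEN free_module_carrierD(1)] that[THEN free_module_carrierD(2)]
        that[THEN free_module_carrierD(3)] in auto)
  show "abelian_group (free_module R X)"
  proof (rule abelian_groupI)
    show "\<zero>\<^bsub>free_module R X\<^esub> \<in> carrier (free_module R X)"
      by (rule free_module_carrierI[where S = "{}"]) auto
  next
    fix f assume f: "f \<in> carrier (free_module R X)"
    have "(\<lambda>x. \<ominus> f x) \<in> carrier (free_module R X)"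
      by (rule free_module_carrierI[where S = "{x. f x \<noteq> \<zero>}"]) (use free_module_carrierD[OF f] in auto)
    moreover have "(\<lambda>x. \<ominus> f x) \<oplus>\<^bsub>free_module R X\<^esub> f = \<zero>\<^bsub>free_module R X\<^esub>"
      using free_module_carrierD(1)[OF f] by (auto simp: l_neg)
    ultimately show "\<exists>g\<in>carrier (free_module R X). g \<oplus>\<^bsub>free_module R X\<^esub> f = \<zero>\<^bsub>free_module R X\<^esub>"
      by blast
  qed (use add_closed in \<open>auto simp: a_ac free_module_carrierD(1) fun_eq_iff\<close>)
  show "a \<odot>\<^bsub>free_module R X\<^esub> f \<in> carrier (free_module R X)"
    if "a \<in> carrier R" "f \<in> carrier (free_module R X)" for a f
    by (rule free_module_carrierI[where S = "{x. f x \<noteq> \<zero>}"])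
      (use that free_module_carrierD[OF that(2)] in auto)
qed (auto simp: l_distr r_distr m_assoc free_module_carrierD(1) fun_eq_iff is_cring)

lemma (in cring) basis_elem_closed [simp]: "x \<in> X \<Longrightarrow> basis_elem R x \<in> carrier (free_module R X)"
  by (rule free_module_carrierI[where S = "{x}"]) (auto simp: basis_elem_def)

lemma (in cring) free_module_induct [consumes 1, case_names zero smult_basis add]:
  assumes f: "f \<in> carrier (free_module R X)"
    and zero: "P \<zero>\<^bsub>free_module R X\<^esub>"
    and basis: "\<And>a x. \<lbrakk>a \<in> carrier R; x \<in> X\<rbrakk> \<Longrightarrow> P (a \<odot>\<^bsub>free_module R X\<^esub> basis_elem R x)"
    and add: "\<And>f g. \<lbrakk>f \<in> carrier (free_module R X); g \<in> carrier (free_module R X); P f; P g\<rbrakk>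
      \<Longrightarrow> P (f \<oplus>\<^bsub>free_module R X\<^esub> g)"
  shows "P f"
proof -
  interpret F: module R "free_module R X" by (rule free_module_is_module)
  have "f \<in> carrier (free_module R X) \<Longrightarrow> {x. f x \<noteq> \<zero>} \<subseteq> S \<Longrightarrow> P f"
    if "finite S" "S \<subseteq> X" for S f
    using that
  proof (induction S arbitrary: f rule: finite_induct)
    case empty
    then have "f = \<zero>\<^bsub>free_module R X\<^esub>" by auto
    then show ?case using zero by simp
  next
    case (insert y S)
    let ?g = "f(y := \<zero>)" and ?b = "f y \<odot>\<^bsub>free_module R X\<^esub> basis_elem R y"
    note fc = free_module_carrierD(1)[OF insert.prems(1)]
    have g: "?g \<in> carrier (free_module R X)"
      by (rule free_module_carrierI[where S = S]) (use insert fc in auto)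
    have b: "?b \<in> carrier (free_module R X)"
      by (rule F.smult_closed) (use insert fc basis_elem_closed in auto)
    have "P ?g" by (rule insert.IH[OF g]) (use insert.prems in auto)
    moreover have "P ?b" using basis fc insert.prems by blast
    moreover have "f = ?g \<oplus>\<^bsub>free_module R X\<^esub> ?b"
      using fc by (auto simp: basis_elem_def)
    ultimately show ?case using add[OF g b] by simp
  qed
  from this[OF _ _ f] free_module_carrierD(2,3)[OF f] show ?thesis by blast
qed

text \<open>The value at \<open>f\<close> of the linear map on a free module that takes the basis element of \<open>x\<close> to \<open>\<phi> x\<close>.\<close>

definition linear_extension ::
    "('r, 's) ring_scheme \<Rightarrow> ('r, 'm, 't) module_scheme \<Rightarrow> ('x \<Rightarrow> 'm) \<Rightarrow> ('x \<Rightarrow> 'r) \<Rightarrow> 'm"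
  where "linear_extension R M \<phi> f = (\<Oplus>\<^bsub>M\<^esub>x\<in>{x. f x \<noteq> \<zero>\<^bsub>R\<^esub>}. f x \<odot>\<^bsub>M\<^esub> \<phi> x)"

lemma linear_mapD:
  assumes "linear_map R M N h"
  shows "x \<in> carrier M \<Longrightarrow> h x \<in> carrier N"
    and "x \<in> carrier M \<Longrightarrow> y \<in> carrier M \<Longrightarrow> h (x \<oplus>\<^bsub>M\<^esub> y) = h x \<oplus>\<^bsub>N\<^esub> h y"
    and "a \<in> carrier R \<Longrightarrow> x \<in> carrier M \<Longrightarrow> h (a \<odot>\<^bsub>M\<^esub> x) = a \<odot>\<^bsub>N\<^esub> h x"
  using assms by (auto simp: linear_map_def)

lemma linear_map_zero:
  assumes "module R M" "module R N" "linear_map R M N h"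
  shows "h \<zero>\<^bsub>M\<^esub> = \<zero>\<^bsub>N\<^esub>"
proof -
  interpret M: module R M by fact
  interpret N: module R N by fact
  have "h (\<zero>\<^bsub>R\<^esub> \<odot>\<^bsub>M\<^esub> \<zero>\<^bsub>M\<^esub>) = \<zero>\<^bsub>R\<^esub> \<odot>\<^bsub>N\<^esub> h \<zero>\<^bsub>M\<^esub>"
    using linear_mapD(3)[OF assms(3)] M.R.zero_closed M.M.zero_closed by blast
  then show ?thesis using linear_mapD(1)[OF assms(3) M.M.zero_closed] by simp
qed

lemma linear_map_minus:
  assumes "module R M" "module R N" "linear_map R M N h" "x \<in> carrier M" "y \<in> carrier M"
  shows "h (x \<ominus>\<^bsub>M\<^esub> y) = h x \<ominus>\<^bsub>N\<^esub> h y"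
proof -
  interpret M: module R M by fact
  interpret N: module R N by fact
  note h = linear_mapD[OF assms(3)]
  have "h (\<ominus>\<^bsub>M\<^esub> y) \<oplus>\<^bsub>N\<^esub> h y = \<zero>\<^bsub>N\<^esub>"
    using assms h(2)[of "\<ominus>\<^bsub>M\<^esub> y" y] linear_map_zero[OF assms(1-3)] by (simp add: M.M.l_neg)
  then have "h (\<ominus>\<^bsub>M\<^esub> y) = \<ominus>\<^bsub>N\<^esub> h y"
    using N.M.minus_equality h(1) assms by (metis M.M.a_inv_closed)
  then show ?thesis using assms h by (simp add: a_minus_def)
qed

lemma linear_map_vimage_submodule:
  assumes "module R M" "module R L" "linear_map R M L h" "submodule N R L"
  shows "submodule {x \<in> carrier M. h x \<in> N} R M"
proof -
  interpret M: module R M by fact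
  interpret L: module R L by fact
  note h = linear_mapD[OF assms(3)] and N = L.submoduleE[OF assms(4)]
  have h0: "h \<zero>\<^bsub>M\<^esub> \<in> N"
    using linear_map_zero[OF assms(1-3)] subgroup.one_closed[OF submodule.axioms(1)[OF assms(4)]] by simp
  have hneg: "h (\<ominus>\<^bsub>M\<^esub> x) = \<ominus>\<^bsub>L\<^esub> h x" if "x \<in> carrier M" for x
    using linear_map_minus[OF assms(1-3) M.M.zero_closed that] that h(1) linear_map_zero[OF assms(1-3)]
    by (simp add: a_minus_def)
  show ?thesis
    by (rule M.submoduleI) (use h h0 hneg N in auto)
qed

lemma linear_map_kernel_submodule:
  assumes "module R M" "module R N" "linear_map R M N h"
  shows "submodule {x \<in> carrier M. h x = \<zero>\<^bsub>N\<^esub>} R M"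
proof -
  interpret N: module R N by fact
  have "submodule {\<zero>\<^bsub>N\<^esub>} R N"
    by (rule N.submoduleI) (auto intro: N.M.minus_equality)
  from linear_map_vimage_submodule[OF assms this] show ?thesis by simp
qed

lemma submodule_span_incl: "S \<subseteq> submodule_span R M S"
  by (auto simp: submodule_span_def)

lemma submodule_span_minimal: "submodule N R M \<Longrightarrow> S \<subseteq> N \<Longrightarrow> submodule_span R M S \<subseteq> N"
  by (auto simp: submodule_span_def)

lemma (in module) submodule_span_submodule:
  assumes "S \<subseteq> carrier M"
  shows "submodule (submodule_span R M S) R M"
proof (rule submoduleI)
  show "submodule_span R M S \<subseteq> carrier M"
    by (rule submodule_span_minimal[OF carrier_is_submodule assms])
qed (auto simp: submodule_span_def dest: submoduleE submodule.smult_closed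
    intro: subgroup.one_closed[OF submodule.axioms(1), of _ R M, simplified])

context module
begin

lemma linear_extension_superset:
  assumes "f \<in> carrier (free_module R X)" "\<phi> \<in> X \<rightarrow> carrier M"
    and "finite S" "{x. f x \<noteq> \<zero>} \<subseteq> S" "S \<subseteq> X"
  shows "linear_extension R M \<phi> f = (\<Oplus>\<^bsub>M\<^esub>x\<in>S. f x \<odot>\<^bsub>M\<^esub> \<phi> x)"
  unfolding linear_extension_def
  by (rule M.add.finprod_mono_neutral_cong_left) (use assms free_module_carrierD(1)[OF assms(1)] in \<open>auto simp: Pi_iff\<close>)

lemma linear_extension_linear:
  assumes \<phi>: "\<phi> \<in> X \<rightarrow> carrier M"
  shows "linear_map R (free_module R X) M (linear_extension R M \<phi>)"
  unfolding linear_map_def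
proof (intro conjI ballI funcsetI)
  interpret F: module R "free_module R X" by (rule R.free_module_is_module)
  fix f assume f: "f \<in> carrier (free_module R X)"
  note f_simps = free_module_carrierD[OF f]
  have f_in_M: "f x \<odot>\<^bsub>M\<^esub> \<phi> x \<in> carrier M" if "f x \<noteq> \<zero>" for x
    using that f_simps \<phi> by blast
  show "linear_extension R M \<phi> f \<in> carrier M"
    unfolding linear_extension_def by (rule M.finsum_closed) (use f_in_M in auto)
  { fix g assume g: "g \<in> carrier (free_module R X)"
    let ?S = "{x. f x \<noteq> \<zero>} \<union> {x. g x \<noteq> \<zero>}"
    note g_simps = free_module_carrierD[OF g]
    have S: "finite ?S" "?S \<subseteq> X" using f_simps g_simps by auto
    have fg: "f \<oplus>\<^bsub>free_module R X\<^esub> g \<in> carrier (free_module R X)" using f g by (rule F.M.a_closed)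
    have in_M: "\<And>x. x \<in> ?S \<Longrightarrow> \<phi> x \<in> carrier M" using S \<phi> by blast
    have "linear_extension R M \<phi> (f \<oplus>\<^bsub>free_module R X\<^esub> g) =
        (\<Oplus>\<^bsub>M\<^esub>x\<in>?S. (f x \<oplus> g x) \<odot>\<^bsub>M\<^esub> \<phi> x)"
      by (subst linear_extension_superset[OF fg \<phi> S(1) _ S(2)]) auto
    also have "\<dots> = (\<Oplus>\<^bsub>M\<^esub>x\<in>?S. f x \<odot>\<^bsub>M\<^esub> \<phi> x \<oplus>\<^bsub>M\<^esub> g x \<odot>\<^bsub>M\<^esub> \<phi> x)"
      by (rule M.finsum_cong') (use in_M f_simps(1) g_simps(1) in \<open>auto simp: smult_l_distr\<close>)
    also have "\<dots> = (\<Oplus>\<^bsub>M\<^esub>x\<in>?S. f x \<odot>\<^bsub>M\<^esub> \<phi> x) \<oplus>\<^bsub>M\<^esub> (\<Oplus>\<^bsub>M\<^esub>x\<in>?S. g x \<odot>\<^bsub>M\<^esub> \<phi> x)"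
      by (rule M.finsum_addf) (use in_M f_simps(1) g_simps(1) in auto)
    also have "\<dots> = linear_extension R M \<phi> f \<oplus>\<^bsub>M\<^esub> linear_extension R M \<phi> g"
      by (simp add: linear_extension_superset[OF f \<phi> S(1) _ S(2)]
          linear_extension_superset[OF g \<phi> S(1) _ S(2)])
    finally show "linear_extension R M \<phi> (f \<oplus>\<^bsub>free_module R X\<^esub> g) =
      linear_extension R M \<phi> f \<oplus>\<^bsub>M\<^esub> linear_extension R M \<phi> g" . }
  { fix a assume a: "a \<in> carrier R"
    let ?S = "{x. f x \<noteq> \<zero>}"
    have S: "finite ?S" "?S \<subseteq> X" using f_simps by auto
    have af: "a \<odot>\<^bsub>free_module R X\<^esub> f \<in> carrier (free_module R X)" using a f by (rule F.smult_closed)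
    have in_M: "\<And>x. x \<in> ?S \<Longrightarrow> \<phi> x \<in> carrier M" using S \<phi> by blast
    have "linear_extension R M \<phi> (a \<odot>\<^bsub>free_module R X\<^esub> f) =
        (\<Oplus>\<^bsub>M\<^esub>x\<in>?S. (a \<otimes> f x) \<odot>\<^bsub>M\<^esub> \<phi> x)"
      by (subst linear_extension_superset[OF af \<phi> S(1) _ S(2)]) (use a in auto)
    also have "\<dots> = (\<Oplus>\<^bsub>M\<^esub>x\<in>?S. a \<odot>\<^bsub>M\<^esub> (f x \<odot>\<^bsub>M\<^esub> \<phi> x))"
      by (rule M.finsum_cong') (use a in_M f_simps(1) in \<open>auto simp: smult_assoc1\<close>)
    also have "\<dots> = a \<odot>\<^bsub>M\<^esub> linear_extension R M \<phi> f"
      unfolding linear_extension_def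
      by (rule finsum_smult_ldistr[symmetric]) (use a in_M S(1) f_simps(1) in auto)
    finally show "linear_extension R M \<phi> (a \<odot>\<^bsub>free_module R X\<^esub> f) =
      a \<odot>\<^bsub>M\<^esub> linear_extension R M \<phi> f" . }
qed

lemma linear_extension_basis:
  assumes \<phi>: "\<phi> \<in> X \<rightarrow> carrier M" and "x \<in> X"
  shows "linear_extension R M \<phi> (basis_elem R x) = \<phi> x"
proof -
  have "linear_extension R M \<phi> (basis_elem R x) = (\<Oplus>\<^bsub>M\<^esub>y\<in>{x}. basis_elem R x y \<odot>\<^bsub>M\<^esub> \<phi> y)"
    by (rule linear_extension_superset[OF basis_elem_closed[OF \<open>x \<in> X\<close>] \<phi>])
      (use \<open>x \<in> X\<close> in \<open>auto simp: basis_elem_def\<close>)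
  also have "\<dots> = \<phi> x"
    using assms by (simp add: basis_elem_def Pi_iff)
  finally show ?thesis .
qed

end

section \<open>Quotient modules and tensor powers\<close>

context module
begin

lemma submodule_abelian_subgroup:
  assumes "submodule N R M"
  shows "abelian_subgroup N M"
  by (rule abelian_subgroupI3[OF additive_subgroupI[OF submodule.axioms(1)[OF assms]] M.abelian_group_axioms])

lemma coset_eq_iff:
  assumes "submodule N R M" "x \<in> carrier M" "y \<in> carrier M"
  shows "N +>\<^bsub>M\<^esub> x = N +>\<^bsub>M\<^esub> y \<longleftrightarrow> x \<ominus>\<^bsub>M\<^esub> y \<in> N"
proof -
  interpret N: abelian_subgroup N M by (rule submodule_abelian_subgroup[OF assms(1)])
  have "N +>\<^bsub>M\<^esub> x = N +>\<^bsub>M\<^esub> y \<longleftrightarrow> x \<in> N +>\<^bsub>M\<^esub> y"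
    using assms(2,3) N.a_repr_independence' N.a_rcos_self by metis
  also have "\<dots> \<longleftrightarrow> x \<ominus>\<^bsub>M\<^esub> y \<in> N"
    using N.a_rcos_module[OF assms(3,2)] by (simp add: a_minus_def)
  finally show ?thesis .
qed

lemma quot_module_carrier: "carrier (quot_module M N) = (\<lambda>x. N +>\<^bsub>M\<^esub> x) ` carrier M"
  by (auto simp: quot_module_def A_RCOSETS_defs a_r_coset_def)

lemma quot_module_add:
  assumes "submodule N R M" "x \<in> carrier M" "y \<in> carrier M"
  shows "(N +>\<^bsub>M\<^esub> x) \<oplus>\<^bsub>quot_module M N\<^esub> (N +>\<^bsub>M\<^esub> y) = N +>\<^bsub>M\<^esub> (x \<oplus>\<^bsub>M\<^esub> y)"
  using abelian_subgroup.a_rcos_sum[OF submodule_abelian_subgroup[OF assms(1)] assms(2,3)]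
  by (simp add: quot_module_def)

lemma quot_module_smult:
  assumes N: "submodule N R M" and "a \<in> carrier R" "x \<in> carrier M"
  shows "a \<odot>\<^bsub>quot_module M N\<^esub> (N +>\<^bsub>M\<^esub> x) = N +>\<^bsub>M\<^esub> (a \<odot>\<^bsub>M\<^esub> x)"
proof -
  interpret N: abelian_subgroup N M by (rule submodule_abelian_subgroup[OF N])
  have "N +>\<^bsub>M\<^esub> (a \<odot>\<^bsub>M\<^esub> y) = N +>\<^bsub>M\<^esub> (a \<odot>\<^bsub>M\<^esub> x)" if y: "y \<in> N +>\<^bsub>M\<^esub> x" for y
  proof -
    obtain h where h: "h \<in> N" "y = h \<oplus>\<^bsub>M\<^esub> x"
      using y by (auto simp: a_r_coset_def r_coset_def)
    have "a \<odot>\<^bsub>M\<^esub> y = a \<odot>\<^bsub>M\<^esub> h \<oplus>\<^bsub>M\<^esub> a \<odot>\<^bsub>M\<^esub> x"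
      using h assms N.a_Hcarr by (simp add: smult_r_distr)
    then have "a \<odot>\<^bsub>M\<^esub> y \<ominus>\<^bsub>M\<^esub> a \<odot>\<^bsub>M\<^esub> x = a \<odot>\<^bsub>M\<^esub> h"
      using h assms N.a_Hcarr by (simp add: a_minus_def M.a_assoc M.r_neg)
    also have "\<dots> \<in> N" using submoduleE(4)[OF N] h assms by blast
    finally show ?thesis
      using coset_eq_iff[OF N] h assms N.a_Hcarr by simp
  qed
  moreover have "x \<in> N +>\<^bsub>M\<^esub> x" using assms by (simp add: N.a_rcos_self)
  ultimately have "(\<Union>y\<in>N +>\<^bsub>M\<^esub> x. N +>\<^bsub>M\<^esub> (a \<odot>\<^bsub>M\<^esub> y)) = N +>\<^bsub>M\<^esub> (a \<odot>\<^bsub>M\<^esub> x)"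
    by blast
  then show ?thesis by (simp add: quot_module_def)
qed

lemma quot_module_zero:
  assumes "submodule N R M"
  shows "\<zero>\<^bsub>quot_module M N\<^esub> = N +>\<^bsub>M\<^esub> \<zero>\<^bsub>M\<^esub>"
proof -
  interpret N: abelian_subgroup N M by (rule submodule_abelian_subgroup[OF assms])
  show ?thesis using M.a_coset_add_zero N.a_subset by (simp add: quot_module_def)
qed

lemma quot_module_is_module:
  assumes N: "submodule N R M"
  shows "module R (quot_module M N)"
proof -
  note quot = quot_module_add[OF N] quot_module_smult[OF N] quot_module_zero[OF N]
  note carr = quot_module_carrier[of N]
  show ?thesis
  proof (rule moduleI)
    show "abelian_group (quot_module M N)"
    proof (rule abelian_groupI)
      fix X assume "X \<in> carrier (quot_module M N)"
      then obtain x where x: "x \<in> carrier M" "X = N +>\<^bsub>M\<^esub> x" by (auto simp: carr)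
      then have "(N +>\<^bsub>M\<^esub> (\<ominus>\<^bsub>M\<^esub> x)) \<oplus>\<^bsub>quot_module M N\<^esub> X = \<zero>\<^bsub>quot_module M N\<^esub>"
        by (simp add: quot M.l_neg)
      then show "\<exists>Y\<in>carrier (quot_module M N). Y \<oplus>\<^bsub>quot_module M N\<^esub> X = \<zero>\<^bsub>quot_module M N\<^esub>"
        using x by (auto simp: carr)
    qed (auto simp: carr quot M.a_ac)
  qed (auto simp: carr quot smult_l_distr smult_r_distr smult_assoc1 intro: R.is_cring)
qed

lemma coset_linear:
  assumes "submodule N R M"
  shows "linear_map R M (quot_module M N) (\<lambda>x. N +>\<^bsub>M\<^esub> x)"
  by (simp add: linear_map_def quot_module_carrier quot_module_add[OF assms] quot_module_smult[OF assms])

text \<open>The map that a linear map \<open>h\<close> killing \<open>N\<close> induces on the quotient by \<open>N\<close> sends a coset to the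
  value that \<open>h\<close> takes at all of its elements.\<close>

lemma the_elem_coset:
  assumes N: "submodule N R M" and L: "module R L" and h: "linear_map R M L h"
    and ker: "\<And>y. y \<in> N \<Longrightarrow> h y = \<zero>\<^bsub>L\<^esub>" and x: "x \<in> carrier M"
  shows "the_elem (h ` (N +>\<^bsub>M\<^esub> x)) = h x"
proof -
  interpret N: abelian_subgroup N M by (rule submodule_abelian_subgroup[OF N])
  interpret L: module R L by fact
  have "h y = h x" if y: "y \<in> N +>\<^bsub>M\<^esub> x" for y
    using y N.a_Hcarr x linear_mapD[OF h] ker by (auto simp: a_r_coset_def r_coset_def)
  moreover have "x \<in> N +>\<^bsub>M\<^esub> x" using x by (simp add: N.a_rcos_self)
  ultimately have "h ` (N +>\<^bsub>M\<^esub> x) = {h x}" by blast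
  then show ?thesis by simp
qed

end

text \<open>Multilinear maps on families indexed by \<open>I\<close>. Families are extensional functions, and both
  conditions compare the families \<open>x(i := a)\<close> for a fixed \<open>x\<close>; the entry \<open>x i\<close> itself is irrelevant.\<close>

definition multilinear ::
    "('r, 's) ring_scheme \<Rightarrow> ('r, 'm, 't) module_scheme \<Rightarrow> ('r, 'n, 'u) module_scheme \<Rightarrow> 'i set
      \<Rightarrow> (('i \<Rightarrow> 'm) \<Rightarrow> 'n) \<Rightarrow> bool"
  where "multilinear R M N I \<phi> \<longleftrightarrow>
    \<phi> \<in> (I \<rightarrow>\<^sub>E carrier M) \<rightarrow> carrier N \<and>
    (\<forall>x\<in>I \<rightarrow>\<^sub>E carrier M. \<forall>i\<in>I. \<forall>a\<in>carrier M. \<forall>b\<in>carrier M.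
      \<phi> (x(i := a \<oplus>\<^bsub>M\<^esub> b)) = \<phi> (x(i := a)) \<oplus>\<^bsub>N\<^esub> \<phi> (x(i := b))) \<and>
    (\<forall>x\<in>I \<rightarrow>\<^sub>E carrier M. \<forall>i\<in>I. \<forall>a\<in>carrier M. \<forall>c\<in>carrier R.
      \<phi> (x(i := c \<odot>\<^bsub>M\<^esub> a)) = c \<odot>\<^bsub>N\<^esub> \<phi> (x(i := a)))"

lemma multilinear_funcset: "multilinear R M N I \<phi> \<Longrightarrow> \<phi> \<in> (I \<rightarrow>\<^sub>E carrier M) \<rightarrow> carrier N"
  by (simp add: multilinear_def)

lemma PiE_upd: "x \<in> I \<rightarrow>\<^sub>E A \<Longrightarrow> i \<in> I \<Longrightarrow> a \<in> A \<Longrightarrow> x(i := a) \<in> I \<rightarrow>\<^sub>E A"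
  by (auto simp: PiE_iff extensional_def)

text \<open>The map induced by \<open>\<phi>\<close> on a tensor power: a class goes to the common value of the linear extension
  of \<open>\<phi>\<close> at its elements. It is meaningful when \<open>\<phi>\<close> is multilinear.\<close>

definition tensor_lift ::
    "('r, 's) ring_scheme \<Rightarrow> ('r, 'n, 'u) module_scheme \<Rightarrow> (('i \<Rightarrow> 'm) \<Rightarrow> 'n)
      \<Rightarrow> (('i \<Rightarrow> 'm) \<Rightarrow> 'r) set \<Rightarrow> 'n"
  where "tensor_lift R N \<phi> X = the_elem (linear_extension R N \<phi> ` X)"

context module
begin

lemma tensor_free_module: "module R (tensor_free R M I)"
  by (rule R.free_module_is_module)

lemma tensor_rel_generators:
  assumes "x \<in> I \<rightarrow>\<^sub>E carrier M" "i \<in> I" "a \<in> carrier M"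
  shows "b \<in> carrier M \<Longrightarrow> basis_elem R (x(i := a \<oplus>\<^bsub>M\<^esub> b))
        \<ominus>\<^bsub>tensor_free R M I\<^esub> (basis_elem R (x(i := a)) \<oplus>\<^bsub>tensor_free R M I\<^esub> basis_elem R (x(i := b)))
      \<in> tensor_rel R M I" (is "_ \<Longrightarrow> ?add \<in> _")
    and "c \<in> carrier R \<Longrightarrow> basis_elem R (x(i := c \<odot>\<^bsub>M\<^esub> a))
        \<ominus>\<^bsub>tensor_free R M I\<^esub> (c \<odot>\<^bsub>tensor_free R M I\<^esub> basis_elem R (x(i := a)))
      \<in> tensor_rel R M I" (is "_ \<Longrightarrow> ?smult \<in> _")
proof -
  interpret F: module R "tensor_free R M I" by (rule tensor_free_module)
  show "b \<in> carrier M \<Longrightarrow> ?add \<in> tensor_rel R M I"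
    unfolding tensor_rel_def using assms by (intro subsetD[OF submodule_span_incl] UnI1) blast
  show "c \<in> carrier R \<Longrightarrow> ?smult \<in> tensor_rel R M I"
    unfolding tensor_rel_def using assms by (intro subsetD[OF submodule_span_incl] UnI2) blast
qed

lemma tensor_rel_minimal:
  assumes "submodule K R (tensor_free R M I)"
    and "\<And>x i a b. \<lbrakk>x \<in> I \<rightarrow>\<^sub>E carrier M; i \<in> I; a \<in> carrier M; b \<in> carrier M\<rbrakk> \<Longrightarrow>
      basis_elem R (x(i := a \<oplus>\<^bsub>M\<^esub> b))
        \<ominus>\<^bsub>tensor_free R M I\<^esub> (basis_elem R (x(i := a)) \<oplus>\<^bsub>tensor_free R M I\<^esub> basis_elem R (x(i := b))) \<in> K"
    and "\<And>x i a c. \<lbrakk>x \<in> I \<rightarrow>\<^sub>E carrier M; i \<in> I; a \<in> carrier M; c \<in> carrier R\<rbrakk> \<Longrightarrow>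
      basis_elem R (x(i := c \<odot>\<^bsub>M\<^esub> a))
        \<ominus>\<^bsub>tensor_free R M I\<^esub> (c \<odot>\<^bsub>tensor_free R M I\<^esub> basis_elem R (x(i := a))) \<in> K"
  shows "tensor_rel R M I \<subseteq> K"
  unfolding tensor_rel_def by (rule submodule_span_minimal[OF assms(1)]) (auto intro: assms(2,3) simp del: free_module_ops)

lemma tensor_rel_submodule: "submodule (tensor_rel R M I) R (tensor_free R M I)"
proof -
  interpret F: module R "tensor_free R M I" by (rule tensor_free_module)
  have basis: "basis_elem R (x(i := a)) \<in> carrier (tensor_free R M I)"
    if "x \<in> I \<rightarrow>\<^sub>E carrier M" "i \<in> I" "a \<in> carrier M" for x i a
    using that by (intro R.basis_elem_closed PiE_upd)
  show ?thesis
    unfolding tensor_rel_def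
    by (rule F.submodule_span_submodule)
      (use basis in \<open>auto simp del: free_module_ops intro!: F.M.minus_closed F.M.a_closed F.smult_closed\<close>)
qed

lemma tensor_power_module: "module R (tensor_power R M I)"
  unfolding tensor_power_def
  by (rule module.quot_module_is_module[OF tensor_free_module tensor_rel_submodule])

lemma pure_tensor_multilinear: "multilinear R M (tensor_power R M I) I (pure_tensor R M I)"
proof -
  interpret F: module R "tensor_free R M I" by (rule tensor_free_module)
  note N = tensor_rel_submodule[of I]
  note quot = F.quot_module_add[OF N] F.quot_module_smult[OF N]
  show ?thesis
    unfolding multilinear_def tensor_power_def
  proof (intro conjI ballI funcsetI)
    show "pure_tensor R M I x \<in> carrier (quot_module (tensor_free R M I) (tensor_rel R M I))"
      if "x \<in> I \<rightarrow>\<^sub>E carrier M" for x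
      using that by (auto simp: F.quot_module_carrier pure_tensor_def)
    fix x i a assume x: "x \<in> I \<rightarrow>\<^sub>E carrier M" "i \<in> I" "a \<in> carrier M"
    have basis: "basis_elem R (x(i := a)) \<in> carrier (tensor_free R M I)" if "a \<in> carrier M" for a
      using that x by (intro R.basis_elem_closed PiE_upd)
    { fix b assume b: "b \<in> carrier M"
      show "pure_tensor R M I (x(i := a \<oplus>\<^bsub>M\<^esub> b)) =
        pure_tensor R M I (x(i := a)) \<oplus>\<^bsub>quot_module (tensor_free R M I) (tensor_rel R M I)\<^esub>
        pure_tensor R M I (x(i := b))"
        unfolding pure_tensor_def quot(1)[OF basis[OF x(3)] basis[OF b]]
        using tensor_rel_generators(1)[OF x b] basis x b F.coset_eq_iff[OF N] F.M.a_closed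
        by (metis M.a_closed) }
    { fix c assume c: "c \<in> carrier R"
      show "pure_tensor R M I (x(i := c \<odot>\<^bsub>M\<^esub> a)) =
        c \<odot>\<^bsub>quot_module (tensor_free R M I) (tensor_rel R M I)\<^esub> pure_tensor R M I (x(i := a))"
        unfolding pure_tensor_def quot(2)[OF c basis[OF x(3)]]
        using tensor_rel_generators(2)[OF x c] basis x c F.coset_eq_iff[OF N] F.smult_closed
        by (metis smult_closed) }
  qed
qed

lemma tensor_power_induct [consumes 1, case_names zero smult_pure add]:
  assumes X: "X \<in> carrier (tensor_power R M I)"
    and zero: "P \<zero>\<^bsub>tensor_power R M I\<^esub>"
    and pure: "\<And>a x. \<lbrakk>a \<in> carrier R; x \<in> I \<rightarrow>\<^sub>E carrier M\<rbrakk>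
      \<Longrightarrow> P (a \<odot>\<^bsub>tensor_power R M I\<^esub> pure_tensor R M I x)"
    and add: "\<And>X Y. \<lbrakk>X \<in> carrier (tensor_power R M I); Y \<in> carrier (tensor_power R M I); P X; P Y\<rbrakk>
      \<Longrightarrow> P (X \<oplus>\<^bsub>tensor_power R M I\<^esub> Y)"
  shows "P X"
proof -
  interpret F: module R "tensor_free R M I" by (rule tensor_free_module)
  note N = tensor_rel_submodule[of I]
  note coset = linear_mapD[OF F.coset_linear[OF N], folded tensor_power_def]
  obtain f where f: "f \<in> carrier (tensor_free R M I)" "X = tensor_rel R M I +>\<^bsub>tensor_free R M I\<^esub> f"
    using X by (auto simp: tensor_power_def F.quot_module_carrier)
  have "P (tensor_rel R M I +>\<^bsub>tensor_free R M I\<^esub> f)" using f(1)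
  proof (induction f rule: R.free_module_induct)
    case zero
    then show ?case
      using assms(2) by (simp only: tensor_power_def F.quot_module_zero[OF N])
  next
    case (smult_basis a x)
    then show ?case
      using pure[OF smult_basis] coset(3)[of a "basis_elem R x"] R.basis_elem_closed[of x]
      by (simp add: pure_tensor_def del: free_module_ops)
  next
    case (add f g)
    then show ?case using assms(4) coset by (simp del: free_module_ops)
  qed
  then show ?thesis using f by simp
qed

lemma tensor_rel_in_kernel:
  assumes N: "module R N" and \<phi>: "multilinear R M N I \<phi>" and "f \<in> tensor_rel R M I"
  shows "linear_extension R N \<phi> f = \<zero>\<^bsub>N\<^esub>"
proof -
  interpret F: module R "tensor_free R M I" by (rule tensor_free_module)
  interpret N: module R N by fact
  note \<phi>_fun = multilinear_funcset[OF \<phi>]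
  note lin = N.linear_extension_linear[OF \<phi>_fun]
  note basis = N.linear_extension_basis[OF \<phi>_fun] and mem = R.basis_elem_closed
  note linD = linear_mapD[OF lin] linear_map_minus[OF F.module_axioms N lin]
  have "tensor_rel R M I \<subseteq> {f \<in> carrier (tensor_free R M I). linear_extension R N \<phi> f = \<zero>\<^bsub>N\<^esub>}"
  proof (rule tensor_rel_minimal[OF linear_map_kernel_submodule[OF F.module_axioms N lin]])
    fix x i a assume x: "x \<in> I \<rightarrow>\<^sub>E carrier M" "i \<in> I" "a \<in> carrier M"
    note upd = PiE_upd[OF x(1,2)]
    have \<phi>_in: "\<phi> (x(i := a)) \<in> carrier N" if "a \<in> carrier M" for a
      using upd[OF that] \<phi>_fun by blast
    { fix b assume b: "b \<in> carrier M"
      have "\<phi> (x(i := a \<oplus>\<^bsub>M\<^esub> b)) = \<phi> (x(i := a)) \<oplus>\<^bsub>N\<^esub> \<phi> (x(i := b))"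
        using \<phi> x b unfolding multilinear_def by blast
      then show "basis_elem R (x(i := a \<oplus>\<^bsub>M\<^esub> b))
        \<ominus>\<^bsub>tensor_free R M I\<^esub> (basis_elem R (x(i := a)) \<oplus>\<^bsub>tensor_free R M I\<^esub> basis_elem R (x(i := b)))
        \<in> {f \<in> carrier (tensor_free R M I). linear_extension R N \<phi> f = \<zero>\<^bsub>N\<^esub>}"
        using x b \<phi>_in by (simp add: linD basis mem upd del: free_module_ops) (simp add: N.M.r_neg a_minus_def) }
    { fix c assume c: "c \<in> carrier R"
      have "\<phi> (x(i := c \<odot>\<^bsub>M\<^esub> a)) = c \<odot>\<^bsub>N\<^esub> \<phi> (x(i := a))"
        using \<phi> x c unfolding multilinear_def by blast
      then show "basis_elem R (x(i := c \<odot>\<^bsub>M\<^esub> a))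
        \<ominus>\<^bsub>tensor_free R M I\<^esub> (c \<odot>\<^bsub>tensor_free R M I\<^esub> basis_elem R (x(i := a)))
        \<in> {f \<in> carrier (tensor_free R M I). linear_extension R N \<phi> f = \<zero>\<^bsub>N\<^esub>}"
        using x c \<phi>_in by (simp add: linD basis mem upd del: free_module_ops) (simp add: N.M.r_neg a_minus_def) }
  qed
  then show ?thesis using assms by blast
qed

lemma tensor_lift_coset:
  assumes N: "module R N" and \<phi>: "multilinear R M N I \<phi>" and f: "f \<in> carrier (tensor_free R M I)"
  shows "tensor_lift R N \<phi> (tensor_rel R M I +>\<^bsub>tensor_free R M I\<^esub> f) = linear_extension R N \<phi> f"
  unfolding tensor_lift_def
  by (rule module.the_elem_coset[OF tensor_free_module tensor_rel_submodule N
        module.linear_extension_linear[OF N multilinear_funcset[OF \<phi>]] tensor_rel_in_kernel[OF N \<phi>] f])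

lemma tensor_lift_linear:
  assumes N: "module R N" and \<phi>: "multilinear R M N I \<phi>"
  shows "linear_map R (tensor_power R M I) N (tensor_lift R N \<phi>)"
proof -
  interpret F: module R "tensor_free R M I" by (rule tensor_free_module)
  note K = tensor_rel_submodule[of I]
  note coset = linear_mapD[OF F.coset_linear[OF K], folded tensor_power_def]
  have lin: "linear_map R (tensor_free R M I) N (linear_extension R N \<phi>)"
    by (rule module.linear_extension_linear[OF N multilinear_funcset[OF \<phi>]])
  have carr: "carrier (tensor_power R M I) =
      (\<lambda>f. tensor_rel R M I +>\<^bsub>tensor_free R M I\<^esub> f) ` carrier (tensor_free R M I)"
    by (simp add: tensor_power_def F.quot_module_carrier)
  note lift = tensor_lift_coset[OF assms] and lin = linear_mapD[OF lin]
  show ?thesis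
    unfolding linear_map_def carr
  proof (intro conjI ballI funcsetI; elim imageE)
    fix X f assume "X = tensor_rel R M I +>\<^bsub>tensor_free R M I\<^esub> f" "f \<in> carrier (tensor_free R M I)"
    then show "tensor_lift R N \<phi> X \<in> carrier N" using lift lin(1) by simp
  next
    fix X Y f g
    assume "X = tensor_rel R M I +>\<^bsub>tensor_free R M I\<^esub> f" "f \<in> carrier (tensor_free R M I)"
      "Y = tensor_rel R M I +>\<^bsub>tensor_free R M I\<^esub> g" "g \<in> carrier (tensor_free R M I)"
    then show "tensor_lift R N \<phi> (X \<oplus>\<^bsub>tensor_power R M I\<^esub> Y) =
        tensor_lift R N \<phi> X \<oplus>\<^bsub>N\<^esub> tensor_lift R N \<phi> Y"
      by (simp only: lift lin(2) coset(2)[symmetric] F.M.a_closed)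
  next
    fix a X f
    assume "a \<in> carrier R"
      "X = tensor_rel R M I +>\<^bsub>tensor_free R M I\<^esub> f" "f \<in> carrier (tensor_free R M I)"
    then show "tensor_lift R N \<phi> (a \<odot>\<^bsub>tensor_power R M I\<^esub> X) = a \<odot>\<^bsub>N\<^esub> tensor_lift R N \<phi> X"
      by (simp only: lift lin(3) coset(3)[symmetric] F.smult_closed)
  qed
qed

lemma tensor_lift_pure:
  assumes N: "module R N" and \<phi>: "multilinear R M N I \<phi>" and x: "x \<in> I \<rightarrow>\<^sub>E carrier M"
  shows "tensor_lift R N \<phi> (pure_tensor R M I x) = \<phi> x"
  unfolding pure_tensor_def tensor_lift_coset[OF N \<phi> R.basis_elem_closed[OF x]]
  by (rule module.linear_extension_basis[OF N multilinear_funcset[OF \<phi>] x])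

end

lemma linear_map_compose:
  assumes "linear_map R M N h" "linear_map R N L k"
  shows "linear_map R M L (\<lambda>x. k (h x))"
  using linear_mapD[OF assms(1)] linear_mapD[OF assms(2)] by (simp add: linear_map_def)

lemma (in module) linear_map_eq_on_basis:
  assumes "linear_map R (free_module R X) M h" "linear_map R (free_module R X) M k"
    and "\<And>x. x \<in> X \<Longrightarrow> h (basis_elem R x) = k (basis_elem R x)"
    and "f \<in> carrier (free_module R X)"
  shows "h f = k f"
proof -
  note F = R.free_module_is_module[of X]
  show ?thesis
    using assms(4)
  proof (induction f rule: R.free_module_induct)
    case zero
    show ?case using linear_map_zero[OF F module_axioms] assms(1,2) by metis
  next
    case (smult_basis a x)
    then show ?case
      using linear_mapD(3)[OF assms(1)] linear_mapD(3)[OF assms(2)] assms(3) R.basis_elem_closed by metis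
  next
    case (add f g)
    then show ?case using linear_mapD(2)[OF assms(1)] linear_mapD(2)[OF assms(2)] by metis
  qed
qed

section \<open>The monoid algebra of a commutative monoid\<close>

lemma monoid_algebra_simps [simp]:
  "carrier (monoid_algebra R G) = carrier (free_module R (carrier G))"
  "\<zero>\<^bsub>monoid_algebra R G\<^esub> = \<zero>\<^bsub>free_module R (carrier G)\<^esub>"
  "add (monoid_algebra R G) = add (free_module R (carrier G))"
  "smult (monoid_algebra R G) = smult (free_module R (carrier G))"
  "\<one>\<^bsub>monoid_algebra R G\<^esub> = basis_elem R \<one>\<^bsub>G\<^esub>"
  by (simp_all add: monoid_algebra_def)

lemma a_r_coset_monoid_algebra:
  "a_r_coset (monoid_algebra R G) = a_r_coset (free_module R (carrier G))"
  by (simp add: fun_eq_iff a_r_coset_def r_coset_def)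

text \<open>\<open>F\<close> is the free module on a commutative monoid \<open>G\<close>, and \<open>A\<close> is the monoid algebra on it.\<close>

locale comm_monoid_algebra = cring R + G: comm_monoid G for R (structure) and G
begin

abbreviation "F \<equiv> free_module R (carrier G)"
abbreviation "A \<equiv> monoid_algebra R G"

sublocale F: module R F
  by (rule free_module_is_module)

text \<open>The convolution product as a sum over any finite rectangle that contains the supports. With a
  common rectangle for several elements, bilinearity becomes a computation with finite sums.\<close>

lemma monoid_algebra_mult:
  assumes f: "f \<in> carrier F" and g: "g \<in> carrier F"
    and S: "finite S" "{x. f x \<noteq> \<zero>} \<subseteq> S" and T: "finite T" "{x. g x \<noteq> \<zero>} \<subseteq> T"
  shows "(f \<otimes>\<^bsub>A\<^esub> g) z = (\<Oplus>p\<in>S \<times> T. if fst p \<otimes>\<^bsub>G\<^esub> snd p = z then f (fst p) \<otimes> g (snd p) else \<zero>)"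
proof -
  have "(f \<otimes>\<^bsub>A\<^esub> g) z = (\<Oplus>p\<in>{(x, y). f x \<noteq> \<zero> \<and> g y \<noteq> \<zero> \<and> x \<otimes>\<^bsub>G\<^esub> y = z}. f (fst p) \<otimes> g (snd p))"
    by (simp add: monoid_algebra_def)
  also have "\<dots> = (\<Oplus>p\<in>S \<times> T. if fst p \<otimes>\<^bsub>G\<^esub> snd p = z then f (fst p) \<otimes> g (snd p) else \<zero>)"
    by (rule add.finprod_mono_neutral_cong_left)
      (use S T free_module_carrierD(1)[OF f] free_module_carrierD(1)[OF g] in auto)
  finally show ?thesis .
qed

lemma monoid_algebra_mult_closed:
  assumes f: "f \<in> carrier F" and g: "g \<in> carrier F"
  shows "f \<otimes>\<^bsub>A\<^esub> g \<in> carrier F"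
proof -
  note fD = free_module_carrierD[OF f] and gD = free_module_carrierD[OF g]
  let ?S = "{x. f x \<noteq> \<zero>}" and ?T = "{x. g x \<noteq> \<zero>}"
  note eq = monoid_algebra_mult[OF f g fD(2) order_refl gD(2) order_refl]
  show ?thesis
  proof (rule free_module_carrierI[where S = "(\<lambda>p. fst p \<otimes>\<^bsub>G\<^esub> snd p) ` (?S \<times> ?T)"])
    show "(f \<otimes>\<^bsub>A\<^esub> g) z \<in> carrier R" for z
      unfolding eq by (rule finsum_closed) (use fD gD in auto)
    show "(\<lambda>p. fst p \<otimes>\<^bsub>G\<^esub> snd p) ` (?S \<times> ?T) \<subseteq> carrier G"
      using fD(3) gD(3) by (auto simp: subset_iff)
    show "(f \<otimes>\<^bsub>A\<^esub> g) z = \<zero>" if "z \<notin> (\<lambda>p. fst p \<otimes>\<^bsub>G\<^esub> snd p) ` (?S \<times> ?T)" for z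
      unfolding eq by (rule add.finprod_one_eqI) (use that in auto)
  qed (use fD(2) gD(2) in auto)
qed

lemma basis_elem_mult:
  assumes "x \<in> carrier G" "y \<in> carrier G"
  shows "basis_elem R x \<otimes>\<^bsub>A\<^esub> basis_elem R y = basis_elem R (x \<otimes>\<^bsub>G\<^esub> y)"
proof
  fix z
  show "(basis_elem R x \<otimes>\<^bsub>A\<^esub> basis_elem R y) z = basis_elem R (x \<otimes>\<^bsub>G\<^esub> y) z"
    by (subst monoid_algebra_mult[OF basis_elem_closed[OF assms(1)] basis_elem_closed[OF assms(2)],
          where S = "{x}" and T = "{y}"])
      (auto simp: basis_elem_def)
qed

lemma monoid_algebra_mult_linear:
  assumes g: "g \<in> carrier F"
  shows "linear_map R F F (\<lambda>f. f \<otimes>\<^bsub>A\<^esub> g)" and "linear_map R F F (\<lambda>f. g \<otimes>\<^bsub>A\<^esub> f)"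
proof -
  note gD = free_module_carrierD[OF g]
  let ?T = "{x. g x \<noteq> \<zero>}"
  { fix f h assume f: "f \<in> carrier F" and h: "h \<in> carrier F"
    note fD = free_module_carrierD[OF f] and hD = free_module_carrierD[OF h]
    let ?S = "{x. f x \<noteq> \<zero>} \<union> {x. h x \<noteq> \<zero>}"
    have S: "finite ?S" using fD hD by simp
    note fh = F.M.a_closed[OF f h]
    note eql = monoid_algebra_mult[OF f g S _ gD(2) order_refl] monoid_algebra_mult[OF h g S _ gD(2) order_refl]
      monoid_algebra_mult[OF fh g S _ gD(2) order_refl]
    note eqr = monoid_algebra_mult[OF g f gD(2) order_refl S] monoid_algebra_mult[OF g h gD(2) order_refl S]
      monoid_algebra_mult[OF g fh gD(2) order_refl S]
    have sub: "{x. (f \<oplus>\<^bsub>F\<^esub> h) x \<noteq> \<zero>} \<subseteq> ?S" "{x. f x \<noteq> \<zero>} \<subseteq> ?S" "{x. h x \<noteq> \<zero>} \<subseteq> ?S" by auto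
    have "(f \<oplus>\<^bsub>F\<^esub> h) \<otimes>\<^bsub>A\<^esub> g = f \<otimes>\<^bsub>A\<^esub> g \<oplus>\<^bsub>F\<^esub> h \<otimes>\<^bsub>A\<^esub> g"
    proof
      fix z
      have "((f \<oplus>\<^bsub>F\<^esub> h) \<otimes>\<^bsub>A\<^esub> g) z =
        (\<Oplus>p\<in>?S \<times> ?T. (if fst p \<otimes>\<^bsub>G\<^esub> snd p = z then f (fst p) \<otimes> g (snd p) else \<zero>) \<oplus>
          (if fst p \<otimes>\<^bsub>G\<^esub> snd p = z then h (fst p) \<otimes> g (snd p) else \<zero>))"
        unfolding eql(3)[OF sub(1)]
        by (rule finsum_cong') (use fD(1) gD(1) hD(1) in \<open>auto simp: l_distr\<close>)
      also have "\<dots> = (f \<otimes>\<^bsub>A\<^esub> g) z \<oplus> (h \<otimes>\<^bsub>A\<^esub> g) z"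
        unfolding eql(1)[OF sub(2)] eql(2)[OF sub(3)]
        by (rule finsum_addf) (use fD(1) gD(1) hD(1) in auto)
      finally show "((f \<oplus>\<^bsub>F\<^esub> h) \<otimes>\<^bsub>A\<^esub> g) z = (f \<otimes>\<^bsub>A\<^esub> g \<oplus>\<^bsub>F\<^esub> h \<otimes>\<^bsub>A\<^esub> g) z" by simp
    qed
    moreover have "g \<otimes>\<^bsub>A\<^esub> (f \<oplus>\<^bsub>F\<^esub> h) = g \<otimes>\<^bsub>A\<^esub> f \<oplus>\<^bsub>F\<^esub> g \<otimes>\<^bsub>A\<^esub> h"
    proof
      fix z
      have "(g \<otimes>\<^bsub>A\<^esub> (f \<oplus>\<^bsub>F\<^esub> h)) z =
        (\<Oplus>p\<in>?T \<times> ?S. (if fst p \<otimes>\<^bsub>G\<^esub> snd p = z then g (fst p) \<otimes> f (snd p) else \<zero>) \<oplus>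
          (if fst p \<otimes>\<^bsub>G\<^esub> snd p = z then g (fst p) \<otimes> h (snd p) else \<zero>))"
        unfolding eqr(3)[OF sub(1)]
        by (rule finsum_cong') (use fD(1) gD(1) hD(1) in \<open>auto simp: r_distr\<close>)
      also have "\<dots> = (g \<otimes>\<^bsub>A\<^esub> f) z \<oplus> (g \<otimes>\<^bsub>A\<^esub> h) z"
        unfolding eqr(1)[OF sub(2)] eqr(2)[OF sub(3)]
        by (rule finsum_addf) (use fD(1) gD(1) hD(1) in auto)
      finally show "(g \<otimes>\<^bsub>A\<^esub> (f \<oplus>\<^bsub>F\<^esub> h)) z = (g \<otimes>\<^bsub>A\<^esub> f \<oplus>\<^bsub>F\<^esub> g \<otimes>\<^bsub>A\<^esub> h) z" by simp
    qed
    ultimately have "(f \<oplus>\<^bsub>F\<^esub> h) \<otimes>\<^bsub>A\<^esub> g = f \<otimes>\<^bsub>A\<^esub> g \<oplus>\<^bsub>F\<^esub> h \<otimes>\<^bsub>A\<^esub> g \<and>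
      g \<otimes>\<^bsub>A\<^esub> (f \<oplus>\<^bsub>F\<^esub> h) = g \<otimes>\<^bsub>A\<^esub> f \<oplus>\<^bsub>F\<^esub> g \<otimes>\<^bsub>A\<^esub> h" by blast }
  moreover
  { fix a f assume a: "a \<in> carrier R" and f: "f \<in> carrier F"
    note fD = free_module_carrierD[OF f]
    let ?S = "{x. f x \<noteq> \<zero>}"
    note af = F.smult_closed[OF a f]
    have sub: "{x. (a \<odot>\<^bsub>F\<^esub> f) x \<noteq> \<zero>} \<subseteq> ?S" using a by auto
    have "(a \<odot>\<^bsub>F\<^esub> f) \<otimes>\<^bsub>A\<^esub> g = a \<odot>\<^bsub>F\<^esub> (f \<otimes>\<^bsub>A\<^esub> g)"
    proof
      fix z
      have "((a \<odot>\<^bsub>F\<^esub> f) \<otimes>\<^bsub>A\<^esub> g) z =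
          (\<Oplus>p\<in>?S \<times> ?T. a \<otimes> (if fst p \<otimes>\<^bsub>G\<^esub> snd p = z then f (fst p) \<otimes> g (snd p) else \<zero>))"
        unfolding monoid_algebra_mult[OF af g fD(2) sub gD(2) order_refl]
        by (rule finsum_cong') (use a fD(1) gD(1) in \<open>auto simp: m_assoc\<close>)
      also have "\<dots> = a \<otimes> (f \<otimes>\<^bsub>A\<^esub> g) z"
        unfolding monoid_algebra_mult[OF f g fD(2) order_refl gD(2) order_refl]
        by (rule finsum_rdistr[symmetric]) (use a fD(1,2) gD(1,2) in auto)
      finally show "((a \<odot>\<^bsub>F\<^esub> f) \<otimes>\<^bsub>A\<^esub> g) z = (a \<odot>\<^bsub>F\<^esub> (f \<otimes>\<^bsub>A\<^esub> g)) z" by simp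
    qed
    moreover have "g \<otimes>\<^bsub>A\<^esub> (a \<odot>\<^bsub>F\<^esub> f) = a \<odot>\<^bsub>F\<^esub> (g \<otimes>\<^bsub>A\<^esub> f)"
    proof
      fix z
      have "(g \<otimes>\<^bsub>A\<^esub> (a \<odot>\<^bsub>F\<^esub> f)) z =
          (\<Oplus>p\<in>?T \<times> ?S. a \<otimes> (if fst p \<otimes>\<^bsub>G\<^esub> snd p = z then g (fst p) \<otimes> f (snd p) else \<zero>))"
        unfolding monoid_algebra_mult[OF g af gD(2) order_refl fD(2) sub]
        by (rule finsum_cong') (use a fD(1) gD(1) in \<open>auto simp: m_lcomm\<close>)
      also have "\<dots> = a \<otimes> (g \<otimes>\<^bsub>A\<^esub> f) z"
        unfolding monoid_algebra_mult[OF g f gD(2) order_refl fD(2) order_refl]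
        by (rule finsum_rdistr[symmetric]) (use a fD(1,2) gD(1,2) in auto)
      finally show "(g \<otimes>\<^bsub>A\<^esub> (a \<odot>\<^bsub>F\<^esub> f)) z = (a \<odot>\<^bsub>F\<^esub> (g \<otimes>\<^bsub>A\<^esub> f)) z" by simp
    qed
    ultimately have "(a \<odot>\<^bsub>F\<^esub> f) \<otimes>\<^bsub>A\<^esub> g = a \<odot>\<^bsub>F\<^esub> (f \<otimes>\<^bsub>A\<^esub> g) \<and>
      g \<otimes>\<^bsub>A\<^esub> (a \<odot>\<^bsub>F\<^esub> f) = a \<odot>\<^bsub>F\<^esub> (g \<otimes>\<^bsub>A\<^esub> f)" by blast }
  ultimately show "linear_map R F F (\<lambda>f. f \<otimes>\<^bsub>A\<^esub> g)" "linear_map R F F (\<lambda>f. g \<otimes>\<^bsub>A\<^esub> f)"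
    using monoid_algebra_mult_closed g unfolding linear_map_def by (blast, blast)
qed

text \<open>Commutativity, the unit law and associativity are equations between linear maps in each argument,
  so they are checked on basis elements one argument at a time.\<close>

lemma monoid_algebra_cring: "cring A"
proof -
  note mc = monoid_algebra_mult_closed and lin = monoid_algebra_mult_linear
    and basis = basis_elem_closed[of _ "carrier G"]
  note eqI = F.linear_map_eq_on_basis[of "carrier G"]
  have group: "abelian_group A"
  proof -
    have "add_monoid A = add_monoid F" by simp
    then show ?thesis
      using F.M.abelian_group_axioms
      unfolding abelian_group_def abelian_group_axioms_def abelian_monoid_def by simp
  qed
  have comm_basis: "f \<otimes>\<^bsub>A\<^esub> basis_elem R y = basis_elem R y \<otimes>\<^bsub>A\<^esub> f"
    if "f \<in> carrier F" "y \<in> carrier G" for f y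
    by (rule eqI[OF lin(1)[OF basis] lin(2)[OF basis] _ that(1)])
      (use that in \<open>simp_all add: basis_elem_mult G.m_comm\<close>)
  have comm: "f \<otimes>\<^bsub>A\<^esub> g = g \<otimes>\<^bsub>A\<^esub> f" if "f \<in> carrier F" "g \<in> carrier F" for f g
    by (rule eqI[OF lin(2) lin(1) _ that(2)]) (use that comm_basis in auto)
  have one: "\<one>\<^bsub>A\<^esub> \<otimes>\<^bsub>A\<^esub> f = f" if "f \<in> carrier F" for f
    by (rule eqI[OF lin(2) _ _ that, where k = "\<lambda>f. f"])
      (use basis in \<open>simp_all add: basis_elem_mult linear_map_def del: free_module_ops\<close>)
  have assoc_basis2: "(f \<otimes>\<^bsub>A\<^esub> basis_elem R y) \<otimes>\<^bsub>A\<^esub> basis_elem R z =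
      f \<otimes>\<^bsub>A\<^esub> (basis_elem R y \<otimes>\<^bsub>A\<^esub> basis_elem R z)"
    if "f \<in> carrier F" "y \<in> carrier G" "z \<in> carrier G" for f y z
    by (rule eqI[OF linear_map_compose[OF lin(1) lin(1)] lin(1) _ that(1)])
      (use that basis in \<open>simp_all add: basis_elem_mult G.m_assoc\<close>)
  have assoc_basis: "(f \<otimes>\<^bsub>A\<^esub> g) \<otimes>\<^bsub>A\<^esub> basis_elem R z = f \<otimes>\<^bsub>A\<^esub> (g \<otimes>\<^bsub>A\<^esub> basis_elem R z)"
    if "f \<in> carrier F" "g \<in> carrier F" "z \<in> carrier G" for f g z
    by (rule eqI[OF linear_map_compose[OF lin(2) lin(1)] linear_map_compose[OF lin(1) lin(2)] _ that(2)])
      (use that basis assoc_basis2 in simp_all)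
  have assoc: "(f \<otimes>\<^bsub>A\<^esub> g) \<otimes>\<^bsub>A\<^esub> h = f \<otimes>\<^bsub>A\<^esub> (g \<otimes>\<^bsub>A\<^esub> h)"
    if "f \<in> carrier F" "g \<in> carrier F" "h \<in> carrier F" for f g h
    by (rule eqI[OF lin(2) linear_map_compose[OF lin(2) lin(2)] _ that(3)])
      (use that mc assoc_basis in simp_all)
  show ?thesis
  proof (rule cringI[OF group])
    show "comm_monoid A"
      by (rule comm_monoidI) (use mc comm one assoc basis in \<open>simp_all del: free_module_ops\<close>)
    show "(f \<oplus>\<^bsub>A\<^esub> g) \<otimes>\<^bsub>A\<^esub> h = f \<otimes>\<^bsub>A\<^esub> h \<oplus>\<^bsub>A\<^esub> g \<otimes>\<^bsub>A\<^esub> h"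
      if "f \<in> carrier A" "g \<in> carrier A" "h \<in> carrier A" for f g h
      using linear_mapD(2)[OF lin(1)] that by simp
  qed
qed

end

section \<open>Tensor powers of an algebra as rings\<close>

lemma linear_map_ring_hom:
  assumes "algebra R B" "algebra R S" "g \<in> ring_hom B S"
    and "\<And>c b. \<lbrakk>c \<in> carrier R; b \<in> carrier B\<rbrakk> \<Longrightarrow> g (c \<odot>\<^bsub>B\<^esub> b) = c \<odot>\<^bsub>S\<^esub> g b"
  shows "linear_map R B S g"
  using assms ring_hom_closed[OF assms(3)] ring_hom_add[OF assms(3)] by (auto simp: linear_map_def)

lemma multilinear_prod:
  assumes "algebra R S" "finite I" and \<mu>: "\<And>i. i \<in> I \<Longrightarrow> linear_map R M S (\<mu> i)" and M: "module R M"
    and \<phi>: "\<And>x. x \<in> I \<rightarrow>\<^sub>E carrier M \<Longrightarrow> \<phi> x = (\<Otimes>\<^bsub>S\<^esub>i\<in>I. \<mu> i (x i))"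
  shows "multilinear R M S I \<phi>"
proof -
  interpret S: algebra R S by fact
  interpret M: module R M by fact
  have closed: "\<mu> i a \<in> carrier S" if "i \<in> I" "a \<in> carrier M" for i a
    using linear_mapD(1)[OF \<mu>] that by blast
  have closed': "\<mu> i (x i) \<in> carrier S" if "i \<in> I" "x \<in> I \<rightarrow>\<^sub>E carrier M" for i x
    using closed that by blast
  have split: "\<phi> (x(i := a)) = \<mu> i a \<otimes>\<^bsub>S\<^esub> (\<Otimes>\<^bsub>S\<^esub>j\<in>I - {i}. \<mu> j (x j))"
    if x: "x \<in> I \<rightarrow>\<^sub>E carrier M" and i: "i \<in> I" and a: "a \<in> carrier M" for x i a
  proof -
    have "\<phi> (x(i := a)) = (\<Otimes>\<^bsub>S\<^esub>j\<in>insert i (I - {i}). \<mu> j ((x(i := a)) j))"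
      using \<phi> PiE_upd[OF x i a] i by (simp add: insert_absorb)
    also have "\<dots> = \<mu> i a \<otimes>\<^bsub>S\<^esub> (\<Otimes>\<^bsub>S\<^esub>j\<in>I - {i}. \<mu> j ((x(i := a)) j))"
      using closed[OF i a] closed' x \<open>finite I\<close> by (subst S.finprod_insert) auto
    also have "(\<Otimes>\<^bsub>S\<^esub>j\<in>I - {i}. \<mu> j ((x(i := a)) j)) = (\<Otimes>\<^bsub>S\<^esub>j\<in>I - {i}. \<mu> j (x j))"
      by (rule S.finprod_cong') (use closed' x in auto)
    finally show ?thesis .
  qed
  have rest: "(\<Otimes>\<^bsub>S\<^esub>j\<in>I - {i}. \<mu> j (x j)) \<in> carrier S" if "x \<in> I \<rightarrow>\<^sub>E carrier M" for x i
    by (rule S.finprod_closed) (use closed' that in auto)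
  show ?thesis
    unfolding multilinear_def
  proof (intro conjI ballI funcsetI)
    show "\<phi> x \<in> carrier S" if "x \<in> I \<rightarrow>\<^sub>E carrier M" for x
      unfolding \<phi>[OF that] by (rule S.finprod_closed) (use closed' that in auto)
  qed (use closed rest linear_mapD(2,3)[OF \<mu>] in \<open>simp_all add: split S.l_distr S.smult_assoc2\<close>)
qed

lemma product_comm_monoid:
  assumes "cring B"
  shows "comm_monoid (product_group I (\<lambda>_. B))"
proof -
  interpret B: cring B by fact
  show ?thesis
    by (rule comm_monoidI)
      (auto simp: fun_eq_iff PiE_iff extensional_def B.m_ac)
qed

text \<open>In the locale \<open>algebra\<close> the algebra over \<open>R\<close> is called \<open>M\<close>; it is the \<open>B\<close> of the later sections.\<close>

context algebra
begin

abbreviation "tuples I \<equiv> I \<rightarrow>\<^sub>E carrier M"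
abbreviation "tuple_alg I \<equiv> monoid_algebra R (product_group I (\<lambda>_. M))"

lemma tuples_alg: "comm_monoid_algebra R (product_group I (\<lambda>_. M))"
  by (rule comm_monoid_algebra.intro[OF R_cring product_comm_monoid[OF M_cring]])

text \<open>Multiplying a multilinearity relation by the basis element of a tuple \<open>y\<close> gives a multilinearity
  relation again: it multiplies the \<open>i\<close>-th entries by \<open>y i\<close> and the others by the corresponding entries
  of \<open>y\<close>.\<close>

lemma tensor_rel_ideal: "ideal (tensor_rel R M I) (tuple_alg I)"
proof -
  let ?N = "tensor_rel R M I"
  interpret G: comm_monoid_algebra R "product_group I (\<lambda>_. M)" by (rule tuples_alg)
  have F_eq: "G.F = tensor_free R M I" by simp
  interpret A: cring G.A by (rule G.monoid_algebra_cring)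
  note N = tensor_rel_submodule[of I]
  note NE = G.F.submoduleE[unfolded F_eq, OF N]
  note lin = G.monoid_algebra_mult_linear[unfolded F_eq]
  have basis_closed: "basis_elem R y \<in> carrier (tensor_free R M I)" if "y \<in> tuples I" for y
    using that by (rule R.basis_elem_closed)
  have basis: "basis_elem R y \<otimes>\<^bsub>G.A\<^esub> f \<in> ?N" if y: "y \<in> tuples I" and f: "f \<in> ?N" for y f
  proof -
    note liny = lin(2)[OF basis_closed[OF y]]
    note h = linear_mapD[OF liny] linear_map_minus[OF tensor_free_module tensor_free_module liny]
    have mult_upd: "basis_elem R y \<otimes>\<^bsub>G.A\<^esub> basis_elem R (x(i := a)) =
        basis_elem R ((\<lambda>j\<in>I. y j \<otimes>\<^bsub>M\<^esub> x j)(i := y i \<otimes>\<^bsub>M\<^esub> a))"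
      if "x \<in> tuples I" "i \<in> I" "a \<in> carrier M" for x i a
    proof -
      have "(\<lambda>j\<in>I. y j \<otimes>\<^bsub>M\<^esub> (x(i := a)) j) = (\<lambda>j\<in>I. y j \<otimes>\<^bsub>M\<^esub> x j)(i := y i \<otimes>\<^bsub>M\<^esub> a)"
        using that by (auto simp: fun_eq_iff)
      then show ?thesis
        using G.basis_elem_mult[of y "x(i := a)"] y PiE_upd[OF that] by simp
    qed
    have "?N \<subseteq> {f \<in> carrier (tensor_free R M I). basis_elem R y \<otimes>\<^bsub>G.A\<^esub> f \<in> ?N}"
    proof (rule tensor_rel_minimal[OF
          linear_map_vimage_submodule[OF tensor_free_module tensor_free_module liny N]])
      fix x i a assume x: "x \<in> tuples I" "i \<in> I" "a \<in> carrier M"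
      let ?z = "\<lambda>j\<in>I. y j \<otimes>\<^bsub>M\<^esub> x j"
      have z: "?z \<in> tuples I" and yi: "y i \<in> carrier M" using x y by auto
      have ya: "y i \<otimes>\<^bsub>M\<^esub> a \<in> carrier M" using x yi by simp
      interpret F: module R "tensor_free R M I" by (rule tensor_free_module)
      note upd = basis_closed[OF PiE_upd[OF x(1,2)]]
      { fix b assume b: "b \<in> carrier M"
        have "y i \<otimes>\<^bsub>M\<^esub> (a \<oplus>\<^bsub>M\<^esub> b) = y i \<otimes>\<^bsub>M\<^esub> a \<oplus>\<^bsub>M\<^esub> y i \<otimes>\<^bsub>M\<^esub> b"
          using x b yi by (simp add: r_distr)
        then show "basis_elem R (x(i := a \<oplus>\<^bsub>M\<^esub> b)) \<ominus>\<^bsub>tensor_free R M I\<^esub>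
            (basis_elem R (x(i := a)) \<oplus>\<^bsub>tensor_free R M I\<^esub> basis_elem R (x(i := b)))
            \<in> {f \<in> carrier (tensor_free R M I). basis_elem R y \<otimes>\<^bsub>G.A\<^esub> f \<in> ?N}"
          using tensor_rel_generators(1)[OF z x(2) ya, of "y i \<otimes>\<^bsub>M\<^esub> b"] b x yi
          by (simp add: h upd mult_upd del: free_module_ops) }
      { fix c assume c: "c \<in> carrier R"
        have "y i \<otimes>\<^bsub>M\<^esub> (c \<odot>\<^bsub>M\<^esub> a) = c \<odot>\<^bsub>M\<^esub> (y i \<otimes>\<^bsub>M\<^esub> a)"
          using x c yi smult_assoc2[of c a "y i"] by (simp add: m_comm)
        then show "basis_elem R (x(i := c \<odot>\<^bsub>M\<^esub> a)) \<ominus>\<^bsub>tensor_free R M I\<^esub>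
            (c \<odot>\<^bsub>tensor_free R M I\<^esub> basis_elem R (x(i := a)))
            \<in> {f \<in> carrier (tensor_free R M I). basis_elem R y \<otimes>\<^bsub>G.A\<^esub> f \<in> ?N}"
          using tensor_rel_generators(2)[OF z x(2) ya c] c x yi
          by (simp add: h upd mult_upd del: free_module_ops) }
    qed
    then show ?thesis using f by blast
  qed
  have left: "g \<otimes>\<^bsub>G.A\<^esub> f \<in> ?N" if f: "f \<in> ?N" and g: "g \<in> carrier (tensor_free R M I)" for f g
  proof -
    have "f \<in> carrier (tensor_free R M I)" using f NE(1) by blast
    note h = linear_mapD[OF lin(1)[OF this]] and h0 = linear_map_zero[OF tensor_free_module tensor_free_module lin(1)[OF this]]
    show ?thesis using g
    proof (induction g rule: R.free_module_induct)
      case zero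
      show ?case
        unfolding h0 using subgroup.one_closed[OF submodule.axioms(1)[OF N]] by simp
    next
      case (smult_basis a x)
      then show ?case
        using h(3) basis[OF _ f] NE(4) basis_closed by (simp del: free_module_ops)
    next
      case (add g g')
      then show ?case using h(2) NE(5) by (simp del: free_module_ops)
    qed
  qed
  show ?thesis
  proof (rule idealI)
    show "ring G.A" by (rule A.ring_axioms)
    show "subgroup ?N (add_monoid G.A)"
      using submodule.axioms(1)[OF N] by simp
    show "g \<otimes>\<^bsub>G.A\<^esub> f \<in> ?N" if "f \<in> ?N" "g \<in> carrier G.A" for f g
      using left that by simp
    show "f \<otimes>\<^bsub>G.A\<^esub> g \<in> ?N" if "f \<in> ?N" "g \<in> carrier G.A" for f g
      using left[OF that(1)] that A.m_comm[of f g] NE(1) by auto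
  qed
qed

lemma tensor_ring_simps:
  "carrier (tensor_ring R M n) = carrier (tensor_power R M {..n})"
  "X \<oplus>\<^bsub>tensor_ring R M n\<^esub> Y = X \<oplus>\<^bsub>tensor_power R M {..n}\<^esub> Y"
  "\<zero>\<^bsub>tensor_ring R M n\<^esub> = \<zero>\<^bsub>tensor_power R M {..n}\<^esub>"
  by (simp_all add: tensor_ring_def tensor_power_def FactRing_def quot_module_def A_RCOSETS_defs
      set_add_defs)

lemma tensor_ring_cring: "cring (tensor_ring R M n)"
  unfolding tensor_ring_def
  by (rule ideal.quotient_is_cring[OF tensor_rel_ideal
        comm_monoid_algebra.monoid_algebra_cring[OF tuples_alg]])

lemma pure_tensor_mult:
  assumes "x \<in> tuples {..n}" "y \<in> tuples {..n}"
  shows "pure_tensor R M {..n} x \<otimes>\<^bsub>tensor_ring R M n\<^esub> pure_tensor R M {..n} y =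
    pure_tensor R M {..n} (\<lambda>i\<in>{..n}. x i \<otimes>\<^bsub>M\<^esub> y i)"
proof -
  interpret G: comm_monoid_algebra R "product_group {..n} (\<lambda>_. M)" by (rule tuples_alg)
  interpret N: ideal "tensor_rel R M {..n}" G.A by (rule tensor_rel_ideal)
  show ?thesis
    using ring_hom_mult[OF N.rcos_ring_hom, of "basis_elem R x" "basis_elem R y"] assms
      G.basis_elem_mult[of x y] R.basis_elem_closed
    by (simp add: tensor_ring_def pure_tensor_def a_r_coset_monoid_algebra)
qed

lemma pure_tensor_one:
  "\<one>\<^bsub>tensor_ring R M n\<^esub> = pure_tensor R M {..n} (\<lambda>i\<in>{..n}. \<one>\<^bsub>M\<^esub>)"
  by (simp add: tensor_ring_def FactRing_def pure_tensor_def a_r_coset_monoid_algebra)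

lemma pure_tensor_closed: "x \<in> tuples {..n} \<Longrightarrow> pure_tensor R M {..n} x \<in> carrier (tensor_ring R M n)"
  using multilinear_funcset[OF pure_tensor_multilinear[of "{..n}"]]
  unfolding tensor_ring_simps(1) by blast

lemma pure_tensor_upd:
  assumes "x \<in> tuples I" "i \<in> I" "a \<in> carrier M"
  shows "b \<in> carrier M \<Longrightarrow> pure_tensor R M I (x(i := a \<oplus>\<^bsub>M\<^esub> b)) =
      pure_tensor R M I (x(i := a)) \<oplus>\<^bsub>tensor_power R M I\<^esub> pure_tensor R M I (x(i := b))"
    and "c \<in> carrier R \<Longrightarrow> pure_tensor R M I (x(i := c \<odot>\<^bsub>M\<^esub> a)) =
      c \<odot>\<^bsub>tensor_power R M I\<^esub> pure_tensor R M I (x(i := a))"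
  using pure_tensor_multilinear[of I] assms unfolding multilinear_def by blast+

text \<open>The pure tensors generate the ring additively; scalars from \<open>R\<close> are not needed, because they can be
  moved into the entry at index \<open>0\<close>.\<close>

lemma tensor_ring_induct [consumes 1, case_names pure add]:
  assumes X: "X \<in> carrier (tensor_ring R M n)"
    and pure: "\<And>x. x \<in> tuples {..n} \<Longrightarrow> P (pure_tensor R M {..n} x)"
    and add: "\<And>X Y. \<lbrakk>X \<in> carrier (tensor_ring R M n); Y \<in> carrier (tensor_ring R M n); P X; P Y\<rbrakk>
      \<Longrightarrow> P (X \<oplus>\<^bsub>tensor_ring R M n\<^esub> Y)"
  shows "P X"
proof -
  have smult: "P (a \<odot>\<^bsub>tensor_power R M {..n}\<^esub> pure_tensor R M {..n} x)"
    if "a \<in> carrier R" "x \<in> tuples {..n}" for a x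
  proof -
    have "x 0 \<in> carrier M" using that by auto
    then show ?thesis
      using pure_tensor_upd(2)[OF that(2), of 0 "x 0" a] that
        pure[OF PiE_upd[OF that(2), of 0 "a \<odot>\<^bsub>M\<^esub> x 0"]] by simp
  qed
  show ?thesis
    using X unfolding tensor_ring_simps(1)
  proof (induction X rule: tensor_power_induct)
    case zero
    interpret T: module R "tensor_power R M {..n}" by (rule tensor_power_module)
    \<comment> \<open>zero is the multiple by \<open>0\<close> of the unit tensor, hence itself a pure tensor\<close>
    let ?x = "\<lambda>i\<in>{..n}. \<one>\<^bsub>M\<^esub>"
    have x: "?x \<in> tuples {..n}" by auto
    have "pure_tensor R M {..n} ?x \<in> carrier (tensor_power R M {..n})"
      using pure_tensor_closed[OF x] by (simp add: tensor_ring_simps)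
    then show ?case using smult[OF R.zero_closed x] by simp
  next
    case (smult_pure a x)
    then show ?case by (rule smult)
  next
    case (add X Y)
    then show ?case using assms(3) by (simp add: tensor_ring_simps)
  qed
qed

lemma place_tuple: "b \<in> carrier M \<Longrightarrow> (\<lambda>j\<in>{..n}. if j = i then b else \<one>\<^bsub>M\<^esub>) \<in> tuples {..n}"
  by auto

lemma place_upd:
  assumes "i \<le> n"
  shows "place R M n i b = pure_tensor R M {..n} ((\<lambda>j\<in>{..n}. \<one>\<^bsub>M\<^esub>)(i := b))"
proof -
  have "(\<lambda>j\<in>{..n}. if j = i then b else \<one>\<^bsub>M\<^esub>) = (\<lambda>j\<in>{..n}. \<one>\<^bsub>M\<^esub>)(i := b)"
    using assms by (auto simp: fun_eq_iff)
  then show ?thesis by (simp add: place_def)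
qed

lemma place_ring_hom:
  assumes i: "i \<le> n"
  shows "place R M n i \<in> ring_hom M (tensor_ring R M n)"
proof (rule ring_hom_memI)
  show "place R M n i b \<in> carrier (tensor_ring R M n)" if "b \<in> carrier M" for b
    unfolding place_def by (rule pure_tensor_closed[OF place_tuple[OF that]])
  show "place R M n i (a \<otimes>\<^bsub>M\<^esub> b) = place R M n i a \<otimes>\<^bsub>tensor_ring R M n\<^esub> place R M n i b"
    if "a \<in> carrier M" "b \<in> carrier M" for a b
    unfolding place_def pure_tensor_mult[OF that[THEN place_tuple]]
    by (rule arg_cong[where f = "pure_tensor R M {..n}"]) (auto simp: fun_eq_iff)
  show "place R M n i (a \<oplus>\<^bsub>M\<^esub> b) = place R M n i a \<oplus>\<^bsub>tensor_ring R M n\<^esub> place R M n i b"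
    if "a \<in> carrier M" "b \<in> carrier M" for a b
    unfolding place_upd[OF i] tensor_ring_simps
    by (rule pure_tensor_upd(1)) (use that i in auto)
  show "place R M n i \<one>\<^bsub>M\<^esub> = \<one>\<^bsub>tensor_ring R M n\<^esub>"
    unfolding place_def pure_tensor_one by (rule arg_cong[where f = "pure_tensor R M {..n}"]) auto
qed

lemma place_smult:
  assumes i: "i \<le> n" and "c \<in> carrier R" "b \<in> carrier M"
  shows "place R M n i (c \<odot>\<^bsub>M\<^esub> b) = c \<odot>\<^bsub>tensor_power R M {..n}\<^esub> place R M n i b"
  unfolding place_upd[OF i] by (rule pure_tensor_upd(2)) (use assms in auto)

lemma place_scalar:
  assumes "i \<le> n" "j \<le> n" "c \<in> carrier R"
  shows "place R M n i (c \<odot>\<^bsub>M\<^esub> \<one>\<^bsub>M\<^esub>) = place R M n j (c \<odot>\<^bsub>M\<^esub> \<one>\<^bsub>M\<^esub>)"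
  using assms place_smult ring_hom_one[OF place_ring_hom] by simp

lemma pure_tensor_eq_prod:
  assumes x: "x \<in> tuples {..n}"
  shows "pure_tensor R M {..n} x = (\<Otimes>\<^bsub>tensor_ring R M n\<^esub>i\<in>{..n}. place R M n i (x i))"
proof -
  interpret T: cring "tensor_ring R M n" by (rule tensor_ring_cring)
  have xi: "x i \<in> carrier M" if "i \<le> n" for i using x that by auto
  have "(\<Otimes>\<^bsub>tensor_ring R M n\<^esub>i\<in>S. place R M n i (x i)) =
      pure_tensor R M {..n} (\<lambda>j\<in>{..n}. if j \<in> S then x j else \<one>\<^bsub>M\<^esub>)"
    if "finite S" "S \<subseteq> {..n}" for S
    using that
  proof (induction S rule: finite_induct)
    case empty
    show ?case by (simp add: pure_tensor_one restrict_def)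
  next
    case (insert k S)
    have "(\<Otimes>\<^bsub>tensor_ring R M n\<^esub>i\<in>insert k S. place R M n i (x i)) = place R M n k (x k)
        \<otimes>\<^bsub>tensor_ring R M n\<^esub> (\<Otimes>\<^bsub>tensor_ring R M n\<^esub>i\<in>S. place R M n i (x i))"
      by (rule T.finprod_insert) (use insert xi ring_hom_closed[OF place_ring_hom] in auto)
    also have "(\<Otimes>\<^bsub>tensor_ring R M n\<^esub>i\<in>S. place R M n i (x i)) =
        pure_tensor R M {..n} (\<lambda>j\<in>{..n}. if j \<in> S then x j else \<one>\<^bsub>M\<^esub>)"
      using insert.IH insert.prems by blast
    also have "place R M n k (x k) \<otimes>\<^bsub>tensor_ring R M n\<^esub> \<dots> =
        pure_tensor R M {..n} (\<lambda>j\<in>{..n}. if j \<in> insert k S then x j else \<one>\<^bsub>M\<^esub>)"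
      unfolding place_def
      by (subst pure_tensor_mult)
        (use insert xi in \<open>auto simp: fun_eq_iff intro!: arg_cong[where f = "pure_tensor R M {..n}"]\<close>)
    finally show ?case .
  qed
  from this[of "{..n}"] have "(\<Otimes>\<^bsub>tensor_ring R M n\<^esub>i\<in>{..n}. place R M n i (x i)) =
      pure_tensor R M {..n} (\<lambda>j\<in>{..n}. if j \<in> {..n} then x j else \<one>\<^bsub>M\<^esub>)" by simp
  moreover have "(\<lambda>j\<in>{..n}. if j \<in> {..n} then x j else \<one>\<^bsub>M\<^esub>) = x"
    using x by (auto simp: fun_eq_iff PiE_iff extensional_def)
  ultimately show ?thesis by simp
qed

text \<open>Algebra maps \<open>g i\<close> from the factors to a commutative algebra \<open>S\<close> combine to a ring map on the
  tensor power. The function \<open>\<phi>\<close> need only agree with the product of the \<open>g i\<close> on tuples.\<close>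

lemma tensor_lift_ring_hom:
  assumes S: "algebra R S" and g: "\<And>i. i \<le> n \<Longrightarrow> g i \<in> ring_hom M S"
    and g_lin: "\<And>i c b. \<lbrakk>i \<le> n; c \<in> carrier R; b \<in> carrier M\<rbrakk> \<Longrightarrow> g i (c \<odot>\<^bsub>M\<^esub> b) = c \<odot>\<^bsub>S\<^esub> g i b"
    and \<phi>: "\<And>x. x \<in> tuples {..n} \<Longrightarrow> \<phi> x = (\<Otimes>\<^bsub>S\<^esub>i\<in>{..n}. g i (x i))"
  shows "tensor_lift R S \<phi> \<in> ring_hom (tensor_ring R M n) S"
    and "\<lbrakk>i \<le> n; b \<in> carrier M\<rbrakk> \<Longrightarrow> tensor_lift R S \<phi> (place R M n i b) = g i b"
proof -
  interpret S: algebra R S by fact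
  interpret T: cring "tensor_ring R M n" by (rule tensor_ring_cring)
  let ?h = "tensor_lift R S \<phi>"
  have alg: "algebra R M" by (rule algebra_axioms)
  have ml: "multilinear R M S {..n} \<phi>"
    by (rule multilinear_prod[OF S _ _ module_axioms \<phi>])
      (use g g_lin linear_map_ring_hom[OF alg S] in auto)
  note pure = tensor_lift_pure[OF S.module_axioms ml]
  note lin = linear_mapD[OF tensor_lift_linear[OF S.module_axioms ml], folded tensor_ring_simps]
  note g_closed = ring_hom_closed[OF g] and g_mult = ring_hom_mult[OF g] and g_one = ring_hom_one[OF g]
  have \<phi>_mult: "\<phi> (\<lambda>i\<in>{..n}. x i \<otimes>\<^bsub>M\<^esub> y i) = \<phi> x \<otimes>\<^bsub>S\<^esub> \<phi> y"
    if x: "x \<in> tuples {..n}" and y: "y \<in> tuples {..n}" for x y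
  proof -
    have xy: "(\<lambda>i\<in>{..n}. x i \<otimes>\<^bsub>M\<^esub> y i) \<in> tuples {..n}" using x y by auto
    have xi: "x i \<in> carrier M" "y i \<in> carrier M" if "i \<le> n" for i using x y that by auto
    have "\<phi> (\<lambda>i\<in>{..n}. x i \<otimes>\<^bsub>M\<^esub> y i) = (\<Otimes>\<^bsub>S\<^esub>i\<in>{..n}. g i (x i) \<otimes>\<^bsub>S\<^esub> g i (y i))"
      unfolding \<phi>[OF xy] by (rule S.finprod_cong') (use xi g_closed g_mult in auto)
    also have "\<dots> = \<phi> x \<otimes>\<^bsub>S\<^esub> \<phi> y"
      unfolding \<phi>[OF x] \<phi>[OF y] by (rule S.finprod_multf) (use xi g_closed in auto)
    finally show ?thesis .
  qed
  have mult_pure: "?h (pure_tensor R M {..n} x \<otimes>\<^bsub>tensor_ring R M n\<^esub> Y) =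
      ?h (pure_tensor R M {..n} x) \<otimes>\<^bsub>S\<^esub> ?h Y"
    if x: "x \<in> tuples {..n}" and Y: "Y \<in> carrier (tensor_ring R M n)" for x Y
    using Y
  proof (induction Y rule: tensor_ring_induct)
    case (pure y)
    have "(\<lambda>i\<in>{..n}. x i \<otimes>\<^bsub>M\<^esub> y i) \<in> tuples {..n}" using x pure by auto
    then show ?case
      using x pure by (simp add: pure_tensor_mult \<open>\<And>x. x \<in> tuples {..n} \<Longrightarrow> _ = \<phi> x\<close> \<phi>_mult)
  next
    case (add Y Z)
    then show ?case
      using pure_tensor_closed[OF x] by (simp add: T.r_distr lin S.r_distr)
  qed
  have mult: "?h (X \<otimes>\<^bsub>tensor_ring R M n\<^esub> Y) = ?h X \<otimes>\<^bsub>S\<^esub> ?h Y"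
    if X: "X \<in> carrier (tensor_ring R M n)" and Y: "Y \<in> carrier (tensor_ring R M n)" for X Y
    using X
  proof (induction X rule: tensor_ring_induct)
    case (pure x)
    then show ?case using mult_pure Y by blast
  next
    case (add X Z)
    then show ?case using Y by (simp add: T.l_distr lin S.l_distr)
  qed
  show "?h \<in> ring_hom (tensor_ring R M n) S"
  proof (rule ring_hom_memI)
    have one: "(\<lambda>i\<in>{..n}. \<one>\<^bsub>M\<^esub>) \<in> tuples {..n}" by auto
    have "\<phi> (\<lambda>i\<in>{..n}. \<one>\<^bsub>M\<^esub>) = \<one>\<^bsub>S\<^esub>"
      unfolding \<phi>[OF one] by (rule S.finprod_one_eqI) (use g_one in auto)
    then show "?h \<one>\<^bsub>tensor_ring R M n\<^esub> = \<one>\<^bsub>S\<^esub>" by (simp add: pure_tensor_one pure[OF one])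
  qed (use lin mult in auto)
  show "?h (place R M n i b) = g i b" if i: "i \<le> n" and b: "b \<in> carrier M"
  proof -
    have "?h (place R M n i b) = (\<Otimes>\<^bsub>S\<^esub>j\<in>{..n}. g j ((\<lambda>j\<in>{..n}. if j = i then b else \<one>\<^bsub>M\<^esub>) j))"
      unfolding place_def pure[OF place_tuple[OF b]] by (rule \<phi>[OF place_tuple[OF b]])
    also have "\<dots> = (\<Otimes>\<^bsub>S\<^esub>j\<in>{..n}. if i = j then g j b else \<one>\<^bsub>S\<^esub>)"
      by (rule S.finprod_cong') (use g_closed g_one b in auto)
    also have "\<dots> = g i b"
      by (rule S.finprod_singleton) (use i b g_closed in auto)
    finally show ?thesis .
  qed
qed

end

lemma restrict_scalars_simps [simp]:
  "carrier (restrict_scalars h S) = carrier S"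
  "mult (restrict_scalars h S) = mult S"
  "\<one>\<^bsub>restrict_scalars h S\<^esub> = \<one>\<^bsub>S\<^esub>"
  "\<zero>\<^bsub>restrict_scalars h S\<^esub> = \<zero>\<^bsub>S\<^esub>"
  "add (restrict_scalars h S) = add S"
  "b \<odot>\<^bsub>restrict_scalars h S\<^esub> x = h b \<otimes>\<^bsub>S\<^esub> x"
  by (simp_all add: restrict_scalars_def)

lemma restrict_scalars_finprod: "finprod (restrict_scalars h S) f I = finprod S f I"
  by (simp add: finprod_def)

lemma restrict_scalars_algebra:
  assumes "cring R" "cring S" and h: "h \<in> ring_hom R S"
  shows "algebra R (restrict_scalars h S)"
proof -
  interpret R: cring R by fact
  interpret S: cring S by fact
  note h = ring_hom_closed[OF h] ring_hom_mult[OF h] ring_hom_add[OF h] ring_hom_one[OF h]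
  have "cring (restrict_scalars h S)"
  proof (rule cringI)
    show "abelian_group (restrict_scalars h S)"
      by (rule abelian_groupI) (auto simp: S.a_ac intro: bexI[where x = "\<ominus>\<^bsub>S\<^esub> x" for x] S.l_neg)
    show "comm_monoid (restrict_scalars h S)"
      by (rule comm_monoidI) (auto simp: S.m_ac)
  qed (auto simp: S.l_distr)
  then show ?thesis
    by (intro algebraI R.is_cring) (auto simp: h S.l_distr S.r_distr S.m_assoc)
qed

text \<open>The same for ring maps \<open>g i\<close> into a commutative ring that agree on the image of \<open>R\<close>: the ring
  becomes an \<open>R\<close>-algebra by way of \<open>g 0\<close>.\<close>

lemma (in algebra) tensor_ring_universal:
  assumes S: "cring S" and g: "\<And>i. i \<le> n \<Longrightarrow> g i \<in> ring_hom M S"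
    and agree: "\<And>i c. \<lbrakk>i \<le> n; c \<in> carrier R\<rbrakk> \<Longrightarrow> g i (c \<odot>\<^bsub>M\<^esub> \<one>\<^bsub>M\<^esub>) = g 0 (c \<odot>\<^bsub>M\<^esub> \<one>\<^bsub>M\<^esub>)"
  obtains h where "h \<in> ring_hom (tensor_ring R M n) S"
    and "\<And>i b. \<lbrakk>i \<le> n; b \<in> carrier M\<rbrakk> \<Longrightarrow> h (place R M n i b) = g i b"
proof -
  let ?\<rho> = "\<lambda>c. g 0 (c \<odot>\<^bsub>M\<^esub> \<one>\<^bsub>M\<^esub>)"
  let ?S = "restrict_scalars ?\<rho> S"
  have mult: "(c \<odot>\<^bsub>M\<^esub> \<one>\<^bsub>M\<^esub>) \<otimes>\<^bsub>M\<^esub> b = c \<odot>\<^bsub>M\<^esub> b" if "c \<in> carrier R" "b \<in> carrier M" for c b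
    using that smult_assoc2[of c "\<one>\<^bsub>M\<^esub>" b] by simp
  have \<rho>: "?\<rho> \<in> ring_hom R S"
  proof (rule ring_hom_memI)
    show "?\<rho> (a \<otimes> b) = ?\<rho> a \<otimes>\<^bsub>S\<^esub> ?\<rho> b" if "a \<in> carrier R" "b \<in> carrier R" for a b
      using that mult[of a "b \<odot>\<^bsub>M\<^esub> \<one>\<^bsub>M\<^esub>"] ring_hom_mult[OF g[of 0], of "a \<odot>\<^bsub>M\<^esub> \<one>\<^bsub>M\<^esub>" "b \<odot>\<^bsub>M\<^esub> \<one>\<^bsub>M\<^esub>"]
      by (simp add: smult_assoc1)
  qed (use ring_hom_closed[OF g[of 0]] ring_hom_add[OF g[of 0]] ring_hom_one[OF g[of 0]] in
      \<open>auto simp: smult_l_distr\<close>)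
  have alg: "algebra R ?S" by (rule restrict_scalars_algebra[OF R_cring S \<rho>])
  have hom: "ring_hom M ?S = ring_hom M S" "ring_hom (tensor_ring R M n) ?S = ring_hom (tensor_ring R M n) S"
    by (simp_all add: ring_hom_def)
  have g_lin: "g i (c \<odot>\<^bsub>M\<^esub> b) = c \<odot>\<^bsub>?S\<^esub> g i b" if "i \<le> n" "c \<in> carrier R" "b \<in> carrier M" for i c b
    using that agree[OF that(1,2)] ring_hom_mult[OF g[OF that(1)], of "c \<odot>\<^bsub>M\<^esub> \<one>\<^bsub>M\<^esub>" b] mult[OF that(2,3)]
    by simp
  show ?thesis
    using that[OF tensor_lift_ring_hom(1)[where g = g and n = n, OF alg, unfolded hom, OF g g_lin refl]
        tensor_lift_ring_hom(2)[where g = g and n = n, OF alg, unfolded hom, OF g g_lin refl]] by blast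
qed

section \<open>Ring homomorphisms and sums of ideals\<close>

lemma ring_hom_minus:
  assumes "ring R" "ring S" "h \<in> ring_hom R S" "x \<in> carrier R" "y \<in> carrier R"
  shows "h (x \<ominus>\<^bsub>R\<^esub> y) = h x \<ominus>\<^bsub>S\<^esub> h y"
proof -
  interpret h: ring_hom_ring R S h by (rule ring_hom_ringI2[OF assms(1-3)])
  show ?thesis using assms(4,5) by (simp add: a_minus_def)
qed

lemma ring_hom_finprod:
  assumes "cring R" "cring S" "h \<in> ring_hom R S" "f \<in> I \<rightarrow> carrier R"
  shows "h (\<Otimes>\<^bsub>R\<^esub>i\<in>I. f i) = (\<Otimes>\<^bsub>S\<^esub>i\<in>I. h (f i))"
proof -
  interpret R: cring R by fact
  interpret S: cring S by fact
  interpret h: ring_hom_cring R S h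
    by (rule ring_hom_cring.intro[OF assms(1,2)]) (simp add: ring_hom_cring_axioms_def assms(3))
  show ?thesis using h.hom_finprod[OF assms(4)] by (simp add: comp_def)
qed

lemma ring_hom_quot_lift:
  assumes "ring R" "ring S" and h: "h \<in> ring_hom R S" and I: "ideal I R"
    and ker: "\<And>x. x \<in> I \<Longrightarrow> h x = \<zero>\<^bsub>S\<^esub>"
  obtains k where "k \<in> ring_hom (R Quot I) S" and "\<And>x. x \<in> carrier R \<Longrightarrow> k (I +>\<^bsub>R\<^esub> x) = h x"
proof -
  interpret R: ring R by fact
  interpret S: ring S by fact
  interpret I: ideal I R by fact
  define k where "k X = the_elem (h ` X)" for X
  note hD = ring_hom_closed[OF h] ring_hom_add[OF h] ring_hom_mult[OF h] ring_hom_one[OF h]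
  note qD = ring_hom_add[OF I.rcos_ring_hom] ring_hom_mult[OF I.rcos_ring_hom] ring_hom_one[OF I.rcos_ring_hom]
  have k: "k (I +>\<^bsub>R\<^esub> x) = h x" if x: "x \<in> carrier R" for x
  proof -
    have "h y = h x" if "y \<in> I +>\<^bsub>R\<^esub> x" for y
      using that x hD I.Icarr ker by (auto simp: a_r_coset_def r_coset_def)
    moreover have "x \<in> I +>\<^bsub>R\<^esub> x" using x by (simp add: I.a_rcos_self)
    ultimately have "h ` (I +>\<^bsub>R\<^esub> x) = {h x}" by blast
    then show ?thesis by (simp add: k_def)
  qed
  have carr: "carrier (R Quot I) = (\<lambda>x. I +>\<^bsub>R\<^esub> x) ` carrier R"
    by (auto simp: FactRing_def A_RCOSETS_defs a_r_coset_def)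
  have "k \<in> ring_hom (R Quot I) S"
  proof (rule ring_hom_memI; (unfold carr)?)
    fix X assume "X \<in> (\<lambda>x. I +>\<^bsub>R\<^esub> x) ` carrier R"
    then obtain x where x: "x \<in> carrier R" "X = I +>\<^bsub>R\<^esub> x" by blast
    then show "k X \<in> carrier S" by (simp add: k hD)
    fix Y assume "Y \<in> (\<lambda>x. I +>\<^bsub>R\<^esub> x) ` carrier R"
    then obtain y where y: "y \<in> carrier R" "Y = I +>\<^bsub>R\<^esub> y" by blast
    show "k (X \<otimes>\<^bsub>R Quot I\<^esub> Y) = k X \<otimes>\<^bsub>S\<^esub> k Y" using x y by (simp add: k hD flip: qD)
    show "k (X \<oplus>\<^bsub>R Quot I\<^esub> Y) = k X \<oplus>\<^bsub>S\<^esub> k Y" using x y by (simp add: k hD flip: qD)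
  next
    show "k \<one>\<^bsub>R Quot I\<^esub> = \<one>\<^bsub>S\<^esub>" by (simp add: k hD flip: qD)
  qed
  then show ?thesis using that k by blast
qed

lemma ring_hom_genideal_subset:
  assumes "ring R" "ring S" "h \<in> ring_hom R S" "ideal K S" "G \<subseteq> carrier R" "h ` G \<subseteq> K"
    and "x \<in> Idl\<^bsub>R\<^esub> G"
  shows "h x \<in> K"
proof -
  interpret h: ring_hom_ring R S h by (rule ring_hom_ringI2[OF assms(1-3)])
  have "Idl\<^bsub>R\<^esub> G \<subseteq> {r \<in> carrier R. h r \<in> K}"
    by (rule h.R.genideal_minimal[OF h.ideal_vimage[OF assms(4)]]) (use assms in auto)
  then show ?thesis using assms(7) by blast
qed

lemma (in cring) ideal_finsum:
  assumes "finite A" "\<And>a. a \<in> A \<Longrightarrow> ideal (f a) R"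
  shows "ideal (\<Oplus>\<^bsub>ideals_set R\<^esub>a\<in>A. f a) R"
    and "a \<in> A \<Longrightarrow> f a \<subseteq> (\<Oplus>\<^bsub>ideals_set R\<^esub>a\<in>A. f a)"
    and "ideal K R \<Longrightarrow> (\<And>a. a \<in> A \<Longrightarrow> f a \<subseteq> K) \<Longrightarrow> (\<Oplus>\<^bsub>ideals_set R\<^esub>a\<in>A. f a) \<subseteq> K"
proof -
  interpret I: semiring "ideals_set R" by (rule ideals_set_is_semiring)
  have all: "ideal (\<Oplus>\<^bsub>ideals_set R\<^esub>a\<in>A. f a) R \<and> (\<forall>a\<in>A. f a \<subseteq> (\<Oplus>\<^bsub>ideals_set R\<^esub>a\<in>A. f a)) \<and>
    (\<forall>K. ideal K R \<longrightarrow> (\<forall>a\<in>A. f a \<subseteq> K) \<longrightarrow> (\<Oplus>\<^bsub>ideals_set R\<^esub>a\<in>A. f a) \<subseteq> K)"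
    using assms
  proof (induction A rule: finite_induct)
    case empty
    have "{\<zero>} \<subseteq> K" if "ideal K R" for K
      using that by (simp add: additive_subgroup.zero_closed ideal.axioms(1))
    moreover have "\<zero>\<^bsub>ideals_set R\<^esub> = {\<zero>}" by (simp add: ideals_set_def)
    ultimately show ?case unfolding I.finsum_empty using zeroideal by simp
  next
    case (insert a A)
    let ?S = "\<Oplus>\<^bsub>ideals_set R\<^esub>a\<in>A. f a"
    have fa: "ideal (f a) R" and IH: "ideal ?S R" "\<And>b. b \<in> A \<Longrightarrow> f b \<subseteq> ?S"
      "\<And>K. ideal K R \<Longrightarrow> (\<And>b. b \<in> A \<Longrightarrow> f b \<subseteq> K) \<Longrightarrow> ?S \<subseteq> K"
      using insert by auto
    have "(\<Oplus>\<^bsub>ideals_set R\<^esub>a\<in>insert a A. f a) = f a \<oplus>\<^bsub>ideals_set R\<^esub> ?S"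
      by (rule I.finsum_insert) (use insert in \<open>auto simp: ideals_set_def\<close>)
    then have eq: "(\<Oplus>\<^bsub>ideals_set R\<^esub>a\<in>insert a A. f a) = f a <+>\<^bsub>R\<^esub> ?S" by (simp add: ideals_set_def)
    interpret f: ideal "f a" R by (rule fa)
    interpret S: ideal ?S R by (rule IH(1))
    have sum_mem: "x \<oplus> y \<in> f a <+>\<^bsub>R\<^esub> ?S" if "x \<in> f a" "y \<in> ?S" for x y
      using that unfolding set_add_def' by blast
    have incl1: "f a \<subseteq> f a <+>\<^bsub>R\<^esub> ?S"
    proof
      show "x \<in> f a <+>\<^bsub>R\<^esub> ?S" if "x \<in> f a" for x
        using sum_mem[OF that S.zero_closed] f.a_Hcarr[OF that] by simp
    qed
    have incl2: "?S \<subseteq> f a <+>\<^bsub>R\<^esub> ?S"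
    proof
      show "x \<in> f a <+>\<^bsub>R\<^esub> ?S" if "x \<in> ?S" for x
        using sum_mem[OF f.zero_closed that] S.a_Hcarr[OF that] by simp
    qed
    have incl3: "f a <+>\<^bsub>R\<^esub> ?S \<subseteq> K" if K: "ideal K R" "f a \<subseteq> K" "?S \<subseteq> K" for K
    proof
      fix x assume "x \<in> f a <+>\<^bsub>R\<^esub> ?S"
      then obtain y z where "y \<in> f a" "z \<in> ?S" "x = y \<oplus> z" by (auto simp: set_add_def')
      then show "x \<in> K" using K additive_subgroup.a_closed[OF ideal.axioms(1)[OF K(1)]] by blast
    qed
    show ?case
      unfolding eq
    proof (intro conjI ballI allI impI)
      show "f b \<subseteq> f a <+>\<^bsub>R\<^esub> ?S" if "b \<in> insert a A" for b
        using that incl1 order_trans[OF IH(2) incl2] by auto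
      show "f a <+>\<^bsub>R\<^esub> ?S \<subseteq> K" if "ideal K R" "\<forall>b\<in>insert a A. f b \<subseteq> K" for K
        by (rule incl3[OF that(1) _ IH(3)[OF that(1)]]) (use that(2) in auto)
    qed (rule add_ideals[OF fa IH(1)])
  qed
  then show "ideal (\<Oplus>\<^bsub>ideals_set R\<^esub>a\<in>A. f a) R" by blast
  show "a \<in> A \<Longrightarrow> f a \<subseteq> (\<Oplus>\<^bsub>ideals_set R\<^esub>a\<in>A. f a)" using all by blast
  show "ideal K R \<Longrightarrow> (\<And>a. a \<in> A \<Longrightarrow> f a \<subseteq> K) \<Longrightarrow> (\<Oplus>\<^bsub>ideals_set R\<^esub>a\<in>A. f a) \<subseteq> K"
    using all by blast
qed

section \<open>The ideals \<open>J\<^sub>r\<^sub>s\<close> and the maps collapsing an index to 0\<close>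

text \<open>An algebra \<open>B\<close> over \<open>R\<close> and the number \<open>n\<close>. The ring \<open>T\<close> is the tensor power of \<open>B\<close> with factors
  \<open>0, \<dots>, n\<close>, and \<open>JJ\<close> is the sum of the squares of the ideals \<open>J r s\<close>.\<close>

locale tensor_differentials = algebra R B for R (structure) and B (structure) +
  fixes n :: nat
begin

abbreviation "T \<equiv> tensor_ring R B n"
abbreviation "p \<equiv> place R B n"
abbreviation "d \<equiv> dtensor R B n"
abbreviation "J \<equiv> Jrs R B n"
abbreviation "JJ \<equiv> J2 R B n"

sublocale T: cring T
  by (rule tensor_ring_cring)

lemma p_closed [simp]: "i \<le> n \<Longrightarrow> b \<in> carrier B \<Longrightarrow> p i b \<in> carrier T"
  by (rule ring_hom_closed[OF place_ring_hom])

lemma d_closed [simp]: "r \<le> n \<Longrightarrow> s \<le> n \<Longrightarrow> b \<in> carrier B \<Longrightarrow> d r s b \<in> carrier T"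
  by (simp add: dtensor_def)

lemma d_swap: "r \<le> n \<Longrightarrow> s \<le> n \<Longrightarrow> b \<in> carrier B \<Longrightarrow> d s r b = \<ominus>\<^bsub>T\<^esub> d r s b"
  by (simp add: dtensor_def T.minus_eq T.minus_add T.a_comm)

lemma d_same: "r \<le> n \<Longrightarrow> b \<in> carrier B \<Longrightarrow> d r r b = \<zero>\<^bsub>T\<^esub>"
  by (simp add: dtensor_def T.minus_eq T.r_neg)

lemma d_trans:
  "r \<le> n \<Longrightarrow> s \<le> n \<Longrightarrow> t \<le> n \<Longrightarrow> b \<in> carrier B \<Longrightarrow> d r t b = d r s b \<oplus>\<^bsub>T\<^esub> d s t b"
proof -
  assume "r \<le> n" "s \<le> n" "t \<le> n" "b \<in> carrier B"
  then have "p r b \<in> carrier T" "p s b \<in> carrier T" "p t b \<in> carrier T" by auto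
  then show ?thesis unfolding dtensor_def by algebra
qed

lemma J_ideal: "r \<le> n \<Longrightarrow> s \<le> n \<Longrightarrow> ideal (J r s) T"
  unfolding Jrs_def by (rule T.genideal_ideal) auto

lemma d_in_J: "r \<le> n \<Longrightarrow> s \<le> n \<Longrightarrow> b \<in> carrier B \<Longrightarrow> d r s b \<in> J r s"
  unfolding Jrs_def by (rule subsetD[OF T.genideal_self]) auto

lemma J_carrier: "r \<le> n \<Longrightarrow> s \<le> n \<Longrightarrow> x \<in> J r s \<Longrightarrow> x \<in> carrier T"
  using ideal.Icarr[OF J_ideal] by blast

lemma J_minimal:
  assumes "r \<le> n" "s \<le> n" "ideal K T" "\<And>b. b \<in> carrier B \<Longrightarrow> d r s b \<in> K"
  shows "J r s \<subseteq> K"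
  unfolding Jrs_def by (rule T.genideal_minimal) (use assms in auto)

lemma J_swap_subset: "r \<le> n \<Longrightarrow> s \<le> n \<Longrightarrow> J s r \<subseteq> J r s"
  by (rule J_minimal)
    (auto intro: J_ideal d_in_J additive_subgroup.a_inv_closed[OF ideal.axioms(1)[OF J_ideal]]
      simp: d_swap[of r s])

lemma J_same: "r \<le> n \<Longrightarrow> x \<in> J r r \<Longrightarrow> x = \<zero>\<^bsub>T\<^esub>"
  using J_minimal[of r r "{\<zero>\<^bsub>T\<^esub>}"] T.zeroideal by (auto simp: d_same)

lemma finite_pairs: "finite {(r, s). r < s \<and> s \<le> n}"
  by (rule finite_subset[of _ "{..n} \<times> {..n}"]) auto

lemma JJ_summand_ideal:
  "q \<in> {(r, s). r < s \<and> s \<le> n} \<Longrightarrow> ideal (J (fst q) (snd q) \<cdot>\<^bsub>T\<^esub> J (fst q) (snd q)) T"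
  by (rule T.ideal_prod_is_ideal) (auto intro: J_ideal)

lemma JJ_ideal: "ideal JJ T"
  unfolding J2_def by (rule T.ideal_finsum(1)[OF finite_pairs JJ_summand_ideal])

lemma JJ_minimal:
  assumes K: "ideal K T"
    and "\<And>r s x y. \<lbrakk>r < s; s \<le> n; x \<in> J r s; y \<in> J r s\<rbrakk> \<Longrightarrow> x \<otimes>\<^bsub>T\<^esub> y \<in> K"
  shows "JJ \<subseteq> K"
  unfolding J2_def
proof (rule T.ideal_finsum(3)[OF finite_pairs JJ_summand_ideal K])
  fix q assume q: "q \<in> {(r, s). r < s \<and> s \<le> n}"
  show "J (fst q) (snd q) \<cdot>\<^bsub>T\<^esub> J (fst q) (snd q) \<subseteq> K"
  proof
    fix x assume "x \<in> J (fst q) (snd q) \<cdot>\<^bsub>T\<^esub> J (fst q) (snd q)"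
    then show "x \<in> K"
      by induction (use q assms additive_subgroup.a_closed[OF ideal.axioms(1)[OF K]] in auto)
  qed
qed

lemma prod_in_JJ:
  assumes "r \<le> n" "s \<le> n" "x \<in> J r s" "y \<in> J r s"
  shows "x \<otimes>\<^bsub>T\<^esub> y \<in> JJ"
proof -
  have less: "x \<otimes>\<^bsub>T\<^esub> y \<in> JJ" if "r < s" "s \<le> n" "x \<in> J r s" "y \<in> J r s" for r s x y
  proof -
    have "x \<otimes>\<^bsub>T\<^esub> y \<in> J (fst (r, s)) (snd (r, s)) \<cdot>\<^bsub>T\<^esub> J (fst (r, s)) (snd (r, s))"
      using that by (auto intro: ideal_prod.prod)
    moreover have "(r, s) \<in> {(r, s). r < s \<and> s \<le> n}" using that by simp
    note T.ideal_finsum(2)[OF finite_pairs JJ_summand_ideal this]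
    ultimately show ?thesis
      unfolding J2_def by (rule subsetD[rotated])
  qed
  consider "r < s" | "r = s" | "s < r" by linarith
  then show ?thesis
  proof cases
    case 1
    then show ?thesis using less assms by blast
  next
    case 2
    then have "x = \<zero>\<^bsub>T\<^esub>" "y \<in> carrier T" using assms J_same J_carrier by auto
    then show ?thesis by (simp add: additive_subgroup.zero_closed[OF ideal.axioms(1)[OF JJ_ideal]])
  next
    case 3
    then show ?thesis using less assms J_swap_subset[of s r] by blast
  qed
qed

text \<open>The ring endomorphism of \<open>T\<close> that moves the entry at index \<open>i\<close> to index \<open>0\<close>. It is unique, but only
  its existence (from the universal property) and its values at the \<open>p j b\<close> are used.\<close>

definition collapse :: "nat \<Rightarrow> ((nat \<Rightarrow> 'c) \<Rightarrow> 'a) set \<Rightarrow> ((nat \<Rightarrow> 'c) \<Rightarrow> 'a) set"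
  where "collapse i = (SOME h. h \<in> ring_hom T T \<and>
    (\<forall>j\<le>n. \<forall>b\<in>carrier B. h (p j b) = p (if j = i then 0 else j) b))"

lemma collapse_spec: "collapse i \<in> ring_hom T T \<and>
    (\<forall>j\<le>n. \<forall>b\<in>carrier B. collapse i (p j b) = p (if j = i then 0 else j) b)"
proof -
  let ?g = "\<lambda>j. p (if j = i then 0 else j)"
  let ?P = "\<lambda>h. h \<in> ring_hom T T \<and> (\<forall>j\<le>n. \<forall>b\<in>carrier B. h (p j b) = ?g j b)"
  have hom: "?g j \<in> ring_hom B T" if "j \<le> n" for j
    using that by (simp add: place_ring_hom)
  have agree: "?g j (c \<odot>\<^bsub>B\<^esub> \<one>\<^bsub>B\<^esub>) = ?g 0 (c \<odot>\<^bsub>B\<^esub> \<one>\<^bsub>B\<^esub>)" if "j \<le> n" "c \<in> carrier R" for j c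
    by (rule place_scalar) (use that in auto)
  obtain h where "h \<in> ring_hom T T" "\<And>j b. \<lbrakk>j \<le> n; b \<in> carrier B\<rbrakk> \<Longrightarrow> h (p j b) = ?g j b"
    using tensor_ring_universal[where g = ?g, OF T.is_cring hom agree] by metis
  then have "?P h" by simp
  then have "?P (Eps ?P)" by (rule someI[of ?P])
  then show ?thesis unfolding collapse_def .
qed

lemmas collapse_hom = collapse_spec[THEN conjunct1]

lemma collapse_p: "j \<le> n \<Longrightarrow> b \<in> carrier B \<Longrightarrow> collapse i (p j b) = p (if j = i then 0 else j) b"
  using collapse_spec by blast

lemma collapse_d:
  assumes "r \<le> n" "s \<le> n" "b \<in> carrier B"
  shows "collapse i (d r s b) = d (if r = i then 0 else r) (if s = i then 0 else s) b"
  using assms by (simp add: dtensor_def collapse_p ring_hom_minus[OF T.ring_axioms T.ring_axioms collapse_hom])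

lemma collapse_J:
  assumes rs: "r \<le> n" "s \<le> n" and x: "x \<in> J r s"
  shows "collapse i x \<in> J (if r = i then 0 else r) (if s = i then 0 else s)"
proof (rule ring_hom_genideal_subset[OF T.ring_axioms T.ring_axioms collapse_hom])
  show "x \<in> Idl\<^bsub>T\<^esub> (d r s ` carrier B)" using x by (simp add: Jrs_def)
qed (use rs d_in_J in \<open>auto simp: collapse_d intro: J_ideal\<close>)

lemma collapse_JJ:
  assumes "x \<in> JJ"
  shows "collapse i x \<in> JJ"
proof -
  interpret h: ring_hom_ring T T "collapse i"
    by (rule ring_hom_ringI2[OF T.ring_axioms T.ring_axioms collapse_hom])
  have "JJ \<subseteq> {x \<in> carrier T. collapse i x \<in> JJ}"
  proof (rule JJ_minimal[OF h.ideal_vimage[OF JJ_ideal]])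
    fix r s x y assume "r < s" "s \<le> n" "x \<in> J r s" "y \<in> J r s"
    then show "x \<otimes>\<^bsub>T\<^esub> y \<in> {x \<in> carrier T. collapse i x \<in> JJ}"
      using prod_in_JJ[OF _ _ collapse_J[of r s x i] collapse_J[of r s y i]] J_carrier[of r s]
      by (simp add: ring_hom_mult[OF collapse_hom])
  qed
  then show ?thesis using assms by blast
qed

lemma collapse_J0:
  assumes "i \<le> n" "x \<in> J 0 i"
  shows "collapse i x = \<zero>\<^bsub>T\<^esub>"
  using collapse_J[of 0 i x i] assms J_same[of 0] by simp

text \<open>The additive operator \<open>(1 - \<sigma>\<^sub>k) \<dots> (1 - \<sigma>\<^sub>1)\<close> on \<open>T\<close>, where \<open>\<sigma>\<^sub>i\<close> is \<open>collapse i\<close>.\<close>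

primrec reduce :: "nat \<Rightarrow> ((nat \<Rightarrow> 'c) \<Rightarrow> 'a) set \<Rightarrow> ((nat \<Rightarrow> 'c) \<Rightarrow> 'a) set" where
  "reduce 0 x = x"
| "reduce (Suc k) x = reduce k x \<ominus>\<^bsub>T\<^esub> collapse (Suc k) (reduce k x)"

lemma reduce_closed [simp]: "x \<in> carrier T \<Longrightarrow> reduce k x \<in> carrier T"
  by (induction k) (auto intro: ring_hom_closed[OF collapse_hom])

lemma reduce_add:
  "x \<in> carrier T \<Longrightarrow> y \<in> carrier T \<Longrightarrow> reduce k (x \<oplus>\<^bsub>T\<^esub> y) = reduce k x \<oplus>\<^bsub>T\<^esub> reduce k y"
proof (induction k)
  case (Suc k)
  have "reduce k x \<in> carrier T" "reduce k y \<in> carrier T"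
    "collapse (Suc k) (reduce k x) \<in> carrier T" "collapse (Suc k) (reduce k y) \<in> carrier T"
    using Suc.prems ring_hom_closed[OF collapse_hom] by auto
  moreover have "(a \<oplus>\<^bsub>T\<^esub> b) \<ominus>\<^bsub>T\<^esub> (a' \<oplus>\<^bsub>T\<^esub> b') = (a \<ominus>\<^bsub>T\<^esub> a') \<oplus>\<^bsub>T\<^esub> (b \<ominus>\<^bsub>T\<^esub> b')"
    if "a \<in> carrier T" "b \<in> carrier T" "a' \<in> carrier T" "b' \<in> carrier T" for a b a' b'
    using that by algebra
  ultimately show ?case
    using Suc by (simp add: ring_hom_add[OF collapse_hom])
qed simp

text \<open>Since each \<open>\<sigma>\<^sub>i\<close> preserves \<open>JJ\<close>, an element whose images under \<open>\<sigma>\<^sub>1, \<dots>, \<sigma>\<^sub>k\<close> lie in \<open>JJ\<close> is changed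
  only by an element of \<open>JJ\<close>.\<close>

lemma reduce_congruent:
  assumes x: "x \<in> carrier T" and ker: "\<And>i. i \<in> {1..k} \<Longrightarrow> collapse i x \<in> JJ"
  shows "x \<ominus>\<^bsub>T\<^esub> reduce k x \<in> JJ"
  using ker
proof (induction k)
  case 0
  show ?case using x additive_subgroup.zero_closed[OF ideal.axioms(1)[OF JJ_ideal]]
    by (simp add: T.minus_eq T.r_neg)
next
  case (Suc k)
  interpret JJ: ideal JJ T by (rule JJ_ideal)
  let ?y = "reduce k x" and ?c = "collapse (Suc k)"
  have closed: "?y \<in> carrier T" "?c x \<in> carrier T" "?c ?y \<in> carrier T"
    using x ring_hom_closed[OF collapse_hom] by auto
  have IH: "x \<ominus>\<^bsub>T\<^esub> ?y \<in> JJ" using Suc by simp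
  have "?c x \<ominus>\<^bsub>T\<^esub> ?c ?y \<in> JJ"
    using collapse_JJ[OF IH, of "Suc k"] x closed
    by (simp add: ring_hom_minus[OF T.ring_axioms T.ring_axioms collapse_hom])
  then have "?c x \<ominus>\<^bsub>T\<^esub> (?c x \<ominus>\<^bsub>T\<^esub> ?c ?y) \<in> JJ"
    using Suc.prems unfolding T.minus_eq[of "?c x" "?c x \<ominus>\<^bsub>T\<^esub> ?c ?y"]
    by (intro JJ.a_closed JJ.a_inv_closed) auto
  then have "?c ?y \<in> JJ"
    using closed by (simp add: T.minus_eq T.minus_add T.r_neg2)
  then have "(x \<ominus>\<^bsub>T\<^esub> ?y) \<oplus>\<^bsub>T\<^esub> ?c ?y \<in> JJ"
    using IH by (intro JJ.a_closed)
  moreover have "(a \<ominus>\<^bsub>T\<^esub> b) \<oplus>\<^bsub>T\<^esub> c = a \<ominus>\<^bsub>T\<^esub> (b \<ominus>\<^bsub>T\<^esub> c)"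
    if "a \<in> carrier T" "b \<in> carrier T" "c \<in> carrier T" for a b c
    using that by algebra
  ultimately show ?case using x closed by simp
qed

text \<open>As \<open>\<sigma>\<^sub>k\<close> fixes the factors with index other than \<open>k\<close>, the operator \<open>1 - \<sigma>\<^sub>k\<close> replaces the factor
  \<open>p k b\<close> of a product by \<open>p k b - p 0 b = d 0 k b\<close>.\<close>

lemma reduce_pure:
  assumes b: "b \<in> {..n} \<rightarrow> carrier B" and "k \<le> n"
  shows "reduce k (\<Otimes>\<^bsub>T\<^esub>i\<in>{..n}. p i (b i)) =
    p 0 (b 0) \<otimes>\<^bsub>T\<^esub> (\<Otimes>\<^bsub>T\<^esub>i\<in>{1..n}. if i \<le> k then d 0 i (b i) else p i (b i))"
  using \<open>k \<le> n\<close>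
proof (induction k)
  have bi: "b i \<in> carrier B" if "i \<le> n" for i using b that by auto
  case 0
  have "{..n} = insert 0 {1..n}" by auto
  then have "(\<Otimes>\<^bsub>T\<^esub>i\<in>{..n}. p i (b i)) = p 0 (b 0) \<otimes>\<^bsub>T\<^esub> (\<Otimes>\<^bsub>T\<^esub>i\<in>{1..n}. p i (b i))"
    using bi by (simp add: T.finprod_insert)
  also have "(\<Otimes>\<^bsub>T\<^esub>i\<in>{1..n}. p i (b i)) = (\<Otimes>\<^bsub>T\<^esub>i\<in>{1..n}. if i \<le> 0 then d 0 i (b i) else p i (b i))"
    by (rule T.finprod_cong') (use bi in auto)
  finally show ?case by simp
next
  have bi: "b i \<in> carrier B" if "i \<le> n" for i using b that by auto
  case (Suc k)
  let ?f = "\<lambda>i. if i \<le> k then d 0 i (b i) else p i (b i)"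
  let ?P = "\<Otimes>\<^bsub>T\<^esub>i\<in>{1..n} - {Suc k}. ?f i"
  have k: "Suc k \<le> n" by fact
  have f: "?f i \<in> carrier T" if "i \<le> n" for i using bi[OF that] that by auto
  have P: "?P \<in> carrier T" by (rule T.finprod_closed) (use f in auto)
  have split: "(\<Otimes>\<^bsub>T\<^esub>i\<in>{1..n}. g i) = g (Suc k) \<otimes>\<^bsub>T\<^esub> (\<Otimes>\<^bsub>T\<^esub>i\<in>{1..n} - {Suc k}. g i)"
    if "\<And>i. i \<le> n \<Longrightarrow> g i \<in> carrier T" for g
  proof -
    have "{1..n} = insert (Suc k) ({1..n} - {Suc k})" using k by auto
    then show ?thesis
      using T.finprod_insert[of "{1..n} - {Suc k}" "Suc k" g] that k by auto
  qed
  have IH: "reduce k (\<Otimes>\<^bsub>T\<^esub>i\<in>{..n}. p i (b i)) = p 0 (b 0) \<otimes>\<^bsub>T\<^esub> (p (Suc k) (b (Suc k)) \<otimes>\<^bsub>T\<^esub> ?P)"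
    using Suc split[of ?f] f by simp
  have "collapse (Suc k) ?P = ?P"
  proof -
    have "collapse (Suc k) ?P = (\<Otimes>\<^bsub>T\<^esub>i\<in>{1..n} - {Suc k}. collapse (Suc k) (?f i))"
      by (rule ring_hom_finprod[OF T.is_cring T.is_cring collapse_hom]) (use f in auto)
    also have "\<dots> = ?P"
      by (rule T.finprod_cong') (use bi f in \<open>auto simp: collapse_p collapse_d\<close>)
    finally show ?thesis .
  qed
  then have "collapse (Suc k) (p 0 (b 0) \<otimes>\<^bsub>T\<^esub> (p (Suc k) (b (Suc k)) \<otimes>\<^bsub>T\<^esub> ?P)) =
      p 0 (b 0) \<otimes>\<^bsub>T\<^esub> (p 0 (b (Suc k)) \<otimes>\<^bsub>T\<^esub> ?P)"
    using P bi[of 0] bi[OF k] k by (simp add: ring_hom_mult[OF collapse_hom] collapse_p)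
  then have "reduce (Suc k) (\<Otimes>\<^bsub>T\<^esub>i\<in>{..n}. p i (b i)) =
      p 0 (b 0) \<otimes>\<^bsub>T\<^esub> (p (Suc k) (b (Suc k)) \<otimes>\<^bsub>T\<^esub> ?P) \<ominus>\<^bsub>T\<^esub> p 0 (b 0) \<otimes>\<^bsub>T\<^esub> (p 0 (b (Suc k)) \<otimes>\<^bsub>T\<^esub> ?P)"
    by (simp add: IH)
  also have "\<dots> = p 0 (b 0) \<otimes>\<^bsub>T\<^esub> ((p (Suc k) (b (Suc k)) \<ominus>\<^bsub>T\<^esub> p 0 (b (Suc k))) \<otimes>\<^bsub>T\<^esub> ?P)"
  proof -
    have "w \<otimes>\<^bsub>T\<^esub> (x \<otimes>\<^bsub>T\<^esub> z) \<ominus>\<^bsub>T\<^esub> w \<otimes>\<^bsub>T\<^esub> (y \<otimes>\<^bsub>T\<^esub> z) = w \<otimes>\<^bsub>T\<^esub> ((x \<ominus>\<^bsub>T\<^esub> y) \<otimes>\<^bsub>T\<^esub> z)"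
      if "w \<in> carrier T" "x \<in> carrier T" "y \<in> carrier T" "z \<in> carrier T" for w x y z
      using that by algebra
    then show ?thesis using P bi[of 0] bi[OF k] k by simp
  qed
  also have "\<dots> = p 0 (b 0) \<otimes>\<^bsub>T\<^esub> (\<Otimes>\<^bsub>T\<^esub>i\<in>{1..n}. if i \<le> Suc k then d 0 i (b i) else p i (b i))"
  proof -
    have "?P = (\<Otimes>\<^bsub>T\<^esub>i\<in>{1..n} - {Suc k}. if i \<le> Suc k then d 0 i (b i) else p i (b i))"
      by (rule T.finprod_cong') (use bi in auto)
    then show ?thesis
      using split[of "\<lambda>i. if i \<le> Suc k then d 0 i (b i) else p i (b i)"] bi by (simp add: dtensor_def)
  qed
  finally show ?case .
qed

end

section \<open>The module of differentials\<close>

context tensor_differentials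
begin

text \<open>The ring \<open>B \<otimes> B\<close> is the case \<open>n = 1\<close>, whose facts are stated with the numeral \<open>1\<close> and not with \<open>Suc 0\<close>.\<close>

declare One_nat_def [simp del]

abbreviation "T1 \<equiv> tensor_ring R B 1"
abbreviation "I1 \<equiv> diag_ideal R B"
abbreviation "I2 \<equiv> diag_ideal_sq R B"
abbreviation "\<Omega> \<equiv> Omega1 R B"
abbreviation "m \<equiv> mult_map R B"

lemma B_ring: "ring B"
  by (rule cring.axioms(1)[OF M_cring])

sublocale D: tensor_differentials R B 1 ..

lemma univ_deriv_eq: "univ_deriv R B b = I2 +>\<^bsub>T1\<^esub> D.d 0 1 b"
  by (simp add: univ_deriv_def dtensor_def)

lemma mult_map_hom: "m \<in> ring_hom T1 B"
  and mult_map_place: "\<lbrakk>i \<le> 1; b \<in> carrier B\<rbrakk> \<Longrightarrow> m (D.p i b) = b"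
proof -
  have "m = tensor_lift R B (\<lambda>x. x 0 \<otimes>\<^bsub>B\<^esub> x 1)"
    by (simp add: fun_eq_iff mult_map_def tensor_lift_def linear_extension_def[abs_def])
  moreover have "x 0 \<otimes>\<^bsub>B\<^esub> x 1 = (\<Otimes>\<^bsub>B\<^esub>i\<in>{..1}. x i)" if x: "x \<in> tuples {..1::nat}" for x
  proof -
    have "x 0 \<in> carrier B" "x 1 \<in> carrier B" using x by auto
    moreover have "{..1} = {0, 1::nat}" by auto
    ultimately show ?thesis by simp
  qed
  moreover have "(\<lambda>b. b) \<in> ring_hom B B" by (rule ring_hom_memI) auto
  ultimately show "m \<in> ring_hom T1 B" "\<lbrakk>i \<le> 1; b \<in> carrier B\<rbrakk> \<Longrightarrow> m (D.p i b) = b"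
    using tensor_lift_ring_hom[OF algebra_axioms, where g = "\<lambda>_ b. b" and n = 1] by simp_all
qed

lemma diag_ideal_iff: "x \<in> I1 \<longleftrightarrow> x \<in> carrier T1 \<and> m x = \<zero>\<^bsub>B\<^esub>"
  by (simp add: diag_ideal_def a_kernel_def')

lemma diag_ideal_ideal: "ideal I1 T1"
proof -
  interpret m: ring_hom_ring T1 B m
    by (rule ring_hom_ringI2[OF D.T.ring_axioms B_ring mult_map_hom])
  show ?thesis unfolding diag_ideal_def by (rule m.kernel_is_ideal)
qed

lemma diag_ideal_sq_ideal: "ideal I2 T1"
  unfolding diag_ideal_sq_def by (rule D.T.ideal_prod_is_ideal[OF diag_ideal_ideal diag_ideal_ideal])

sublocale I1: ideal I1 T1 by (rule diag_ideal_ideal)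
sublocale I2: ideal I2 T1 by (rule diag_ideal_sq_ideal)
sublocale JJ: ideal JJ T by (rule JJ_ideal)

lemma deriv_in_diag_ideal: "b \<in> carrier B \<Longrightarrow> D.d 0 1 b \<in> I1"
  unfolding diag_ideal_iff
  by (simp add: dtensor_def mult_map_place ring_hom_minus[OF D.T.ring_axioms B_ring mult_map_hom]
      M.minus_eq M.r_neg)

text \<open>The map \<open>X \<mapsto> X - m X \<otimes> 1\<close> is a projection of \<open>B \<otimes> B\<close> onto the kernel of multiplication.\<close>

lemma minus_mult_in_diag_ideal:
  assumes X: "X \<in> carrier T1"
  shows "X \<ominus>\<^bsub>T1\<^esub> D.p 0 (m X) \<in> I1"
proof -
  have "m X \<in> carrier B" by (rule ring_hom_closed[OF mult_map_hom X])
  then show ?thesis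
    unfolding diag_ideal_iff
    using X by (simp add: mult_map_place ring_hom_minus[OF D.T.ring_axioms B_ring mult_map_hom]
        M.minus_eq M.r_neg)
qed

lemma tensor_square_induct [consumes 1, case_names prod add]:
  assumes X: "X \<in> carrier T1"
    and prod: "\<And>a b. \<lbrakk>a \<in> carrier B; b \<in> carrier B\<rbrakk> \<Longrightarrow> P (D.p 0 a \<otimes>\<^bsub>T1\<^esub> D.p 1 b)"
    and add: "\<And>X Y. \<lbrakk>X \<in> carrier T1; Y \<in> carrier T1; P X; P Y\<rbrakk> \<Longrightarrow> P (X \<oplus>\<^bsub>T1\<^esub> Y)"
  shows "P X"
  using X
proof (induction X rule: tensor_ring_induct)
  case (pure x)
  have x: "x 0 \<in> carrier B" "x 1 \<in> carrier B" using pure by auto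
  have "{..1} = {0, 1::nat}" by auto
  then have "pure_tensor R B {..1} x = D.p 0 (x 0) \<otimes>\<^bsub>T1\<^esub> D.p 1 (x 1)"
    unfolding pure_tensor_eq_prod[OF pure] using x by simp
  then show ?case using prod x by simp
next
  case (add X Y)
  then show ?case using assms(3) by blast
qed

lemma scalar_hom: "(\<lambda>b. I2 +>\<^bsub>T1\<^esub> D.p 0 b) \<in> ring_hom B (T1 Quot I2)"
  using ring_hom_trans[OF place_ring_hom I2.rcos_ring_hom, of 0] by (simp add: comp_def)

lemma Omega_carrier: "carrier \<Omega> = (\<lambda>x. I2 +>\<^bsub>T1\<^esub> x) ` I1"
  by (simp add: Omega1_def)

lemma Omega_add:
  "x \<in> I1 \<Longrightarrow> y \<in> I1 \<Longrightarrow> (I2 +>\<^bsub>T1\<^esub> x) \<oplus>\<^bsub>\<Omega>\<^esub> (I2 +>\<^bsub>T1\<^esub> y) = I2 +>\<^bsub>T1\<^esub> (x \<oplus>\<^bsub>T1\<^esub> y)"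
  using ring_hom_add[OF I2.rcos_ring_hom I1.Icarr I1.Icarr] by (simp add: Omega1_def)

lemma Omega_smult:
  "b \<in> carrier B \<Longrightarrow> x \<in> I1 \<Longrightarrow> b \<odot>\<^bsub>\<Omega>\<^esub> (I2 +>\<^bsub>T1\<^esub> x) = I2 +>\<^bsub>T1\<^esub> (D.p 0 b \<otimes>\<^bsub>T1\<^esub> x)"
  using ring_hom_mult[OF I2.rcos_ring_hom D.p_closed[of 0 b] I1.Icarr] by (simp add: Omega1_def)

lemma Omega_module: "module B \<Omega>"
proof -
  let ?S = "restrict_scalars (\<lambda>b. I2 +>\<^bsub>T1\<^esub> D.p 0 b) (T1 Quot I2)" and ?H = "(\<lambda>x. I2 +>\<^bsub>T1\<^esub> x) ` I1"
  have eq: "\<Omega> = ?S\<lparr>carrier := ?H\<rparr>" by (simp add: Omega1_def)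
  interpret S: algebra B ?S
    by (rule restrict_scalars_algebra[OF M_cring I2.quotient_is_cring[OF D.T.is_cring] scalar_hom])
  note add = Omega_add[unfolded eq, simplified] and smult = Omega_smult[unfolded eq, simplified]
  have sub: "?H \<subseteq> carrier ?S"
    using ring_hom_closed[OF I2.rcos_ring_hom I1.Icarr] by auto
  have smult_closed: "b \<odot>\<^bsub>?S\<^esub> w \<in> ?H" if "b \<in> carrier B" "w \<in> ?H" for b w
    using that smult by (auto intro!: imageI I1.I_l_closed)
  have "submodule ?H B ?S"
  proof (rule S.submoduleI[OF sub _ _ _ smult_closed])
    have "I2 +>\<^bsub>T1\<^esub> \<zero>\<^bsub>T1\<^esub> \<in> ?H" using I1.zero_closed by blast
    moreover have "I2 +>\<^bsub>T1\<^esub> \<zero>\<^bsub>T1\<^esub> = \<zero>\<^bsub>?S\<^esub>"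
      using D.T.a_coset_add_zero[OF I2.a_subset] by (simp add: FactRing_def)
    ultimately show "\<zero>\<^bsub>?S\<^esub> \<in> ?H" by simp
    fix w assume w: "w \<in> ?H"
    have "\<ominus>\<^bsub>?S\<^esub> w = (\<ominus>\<^bsub>B\<^esub> \<one>\<^bsub>B\<^esub>) \<odot>\<^bsub>?S\<^esub> w"
      using S.smult_l_minus[of "\<one>\<^bsub>B\<^esub>" w] S.smult_one[of w] w sub by auto
    then show "\<ominus>\<^bsub>?S\<^esub> w \<in> ?H" using smult_closed[OF _ w] by simp
  next
    show "v \<oplus>\<^bsub>?S\<^esub> w \<in> ?H" if "v \<in> ?H" "w \<in> ?H" for v w
      using that add by auto
  qed
  then show ?thesis
    unfolding eq by (rule submodule.submodule_is_module[OF _ S.module_axioms])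
qed

lemma univ_deriv_closed: "b \<in> carrier B \<Longrightarrow> univ_deriv R B b \<in> carrier \<Omega>"
  unfolding univ_deriv_eq Omega_carrier using deriv_in_diag_ideal by blast

text \<open>The differentials \<open>db\<close> generate \<open>\<Omega>\<close> over \<open>B\<close>: the projection above takes \<open>a \<otimes> b\<close> to
  \<open>a \<otimes> b - a b \<otimes> 1\<close>, which represents \<open>a \<cdot> db\<close>.\<close>

lemma Omega_induct [consumes 1, case_names deriv smult add]:
  assumes w: "w \<in> carrier \<Omega>"
    and deriv: "\<And>b. b \<in> carrier B \<Longrightarrow> P (univ_deriv R B b)"
    and smult: "\<And>b v. \<lbrakk>b \<in> carrier B; v \<in> carrier \<Omega>; P v\<rbrakk> \<Longrightarrow> P (b \<odot>\<^bsub>\<Omega>\<^esub> v)"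
    and add: "\<And>v w. \<lbrakk>v \<in> carrier \<Omega>; w \<in> carrier \<Omega>; P v; P w\<rbrakk> \<Longrightarrow> P (v \<oplus>\<^bsub>\<Omega>\<^esub> w)"
  shows "P w"
proof -
  let ?\<pi> = "\<lambda>X. X \<ominus>\<^bsub>T1\<^esub> D.p 0 (m X)"
  note m_closed = ring_hom_closed[OF mult_map_hom]
  have key: "P (I2 +>\<^bsub>T1\<^esub> ?\<pi> X)" if "X \<in> carrier T1" for X
    using that
  proof (induction X rule: tensor_square_induct)
    case (prod a b)
    have "m (D.p 0 a \<otimes>\<^bsub>T1\<^esub> D.p 1 b) = a \<otimes>\<^bsub>B\<^esub> b"
      using prod by (simp add: ring_hom_mult[OF mult_map_hom] mult_map_place)
    moreover have "x \<otimes>\<^bsub>T1\<^esub> y \<ominus>\<^bsub>T1\<^esub> x \<otimes>\<^bsub>T1\<^esub> z = x \<otimes>\<^bsub>T1\<^esub> (y \<ominus>\<^bsub>T1\<^esub> z)"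
      if "x \<in> carrier T1" "y \<in> carrier T1" "z \<in> carrier T1" for x y z
      using that by algebra
    ultimately have "?\<pi> (D.p 0 a \<otimes>\<^bsub>T1\<^esub> D.p 1 b) = D.p 0 a \<otimes>\<^bsub>T1\<^esub> D.d 0 1 b"
      using prod by (simp add: ring_hom_mult[OF place_ring_hom] dtensor_def)
    then have "I2 +>\<^bsub>T1\<^esub> ?\<pi> (D.p 0 a \<otimes>\<^bsub>T1\<^esub> D.p 1 b) = a \<odot>\<^bsub>\<Omega>\<^esub> univ_deriv R B b"
      using prod by (simp add: univ_deriv_eq Omega_smult deriv_in_diag_ideal)
    then show ?case using smult deriv univ_deriv_closed prod by simp
  next
    case (add X Y)
    have "(x \<oplus>\<^bsub>T1\<^esub> y) \<ominus>\<^bsub>T1\<^esub> (x' \<oplus>\<^bsub>T1\<^esub> y') = (x \<ominus>\<^bsub>T1\<^esub> x') \<oplus>\<^bsub>T1\<^esub> (y \<ominus>\<^bsub>T1\<^esub> y')"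
      if "x \<in> carrier T1" "y \<in> carrier T1" "x' \<in> carrier T1" "y' \<in> carrier T1" for x y x' y'
      using that by algebra
    then have "?\<pi> (X \<oplus>\<^bsub>T1\<^esub> Y) = ?\<pi> X \<oplus>\<^bsub>T1\<^esub> ?\<pi> Y"
      using add m_closed by (simp add: ring_hom_add[OF mult_map_hom] ring_hom_add[OF place_ring_hom])
    then have "I2 +>\<^bsub>T1\<^esub> ?\<pi> (X \<oplus>\<^bsub>T1\<^esub> Y) = (I2 +>\<^bsub>T1\<^esub> ?\<pi> X) \<oplus>\<^bsub>\<Omega>\<^esub> (I2 +>\<^bsub>T1\<^esub> ?\<pi> Y)"
      using add minus_mult_in_diag_ideal by (simp add: Omega_add)
    moreover have "I2 +>\<^bsub>T1\<^esub> ?\<pi> X \<in> carrier \<Omega>" if "X \<in> carrier T1" for X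
      using minus_mult_in_diag_ideal[OF that] by (auto simp: Omega_carrier)
    ultimately show ?case using add assms(4) by simp
  qed
  obtain x where x: "x \<in> I1" "w = I2 +>\<^bsub>T1\<^esub> x" using w by (auto simp: Omega_carrier)
  have "D.p 0 (m x) = \<zero>\<^bsub>T1\<^esub>"
    using x ring_hom_zero[OF place_ring_hom[of 0 1] B_ring D.T.ring_axioms]
    by (simp add: diag_ideal_iff)
  then have "?\<pi> x = x" using x I1.Icarr by (simp add: D.T.minus_eq)
  then show ?thesis using key[OF I1.Icarr[OF x(1)]] x(2) by simp
qed

lemma JJ_scalar_hom: "(\<lambda>b. JJ +>\<^bsub>T\<^esub> p 0 b) \<in> ring_hom B (T Quot JJ)"
  using ring_hom_trans[OF place_ring_hom JJ.rcos_ring_hom, of 0] by (simp add: comp_def)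

lemma tensor_quot_algebra: "algebra B (tensor_quot R B n)"
  unfolding tensor_quot_def
  by (rule restrict_scalars_algebra[OF M_cring JJ.quotient_is_cring[OF T.is_cring] JJ_scalar_hom])

lemma tensor_quot_ops:
  "x \<in> carrier T \<Longrightarrow> JJ +>\<^bsub>T\<^esub> x \<in> carrier (tensor_quot R B n)"
  "x \<in> carrier T \<Longrightarrow> y \<in> carrier T \<Longrightarrow>
    (JJ +>\<^bsub>T\<^esub> x) \<oplus>\<^bsub>tensor_quot R B n\<^esub> (JJ +>\<^bsub>T\<^esub> y) = JJ +>\<^bsub>T\<^esub> (x \<oplus>\<^bsub>T\<^esub> y)"
  "b \<in> carrier B \<Longrightarrow> x \<in> carrier T \<Longrightarrow>
    b \<odot>\<^bsub>tensor_quot R B n\<^esub> (JJ +>\<^bsub>T\<^esub> x) = JJ +>\<^bsub>T\<^esub> (p 0 b \<otimes>\<^bsub>T\<^esub> x)"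
  using ring_hom_closed[OF JJ.rcos_ring_hom] ring_hom_add[OF JJ.rcos_ring_hom]
    ring_hom_mult[OF JJ.rcos_ring_hom]
  by (simp_all add: tensor_quot_def)

text \<open>The \<open>i\<close>-th factor of \<open>\<lambda>\<close>. The ring map \<open>h\<close> with \<open>h (a \<otimes> b) = p 0 a \<cdot> p i b\<close> satisfies
  \<open>h X - p 0 (m X) \<in> J 0 i\<close> for all \<open>X\<close>, so it takes the kernel of \<open>m\<close> into \<open>J 0 i\<close> and the square of that
  kernel into \<open>JJ\<close>.\<close>

lemma Omega_to_quot:
  assumes i: "i \<le> n"
  obtains k where "linear_map B \<Omega> (tensor_quot R B n) k"
    and "\<And>b. b \<in> carrier B \<Longrightarrow> k (univ_deriv R B b) = JJ +>\<^bsub>T\<^esub> d 0 i b"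
proof -
  let ?g = "\<lambda>j. p (if j = 0 then 0 else i)"
  have hom: "?g j \<in> ring_hom B T" for j using i by (simp add: place_ring_hom)
  have agree: "?g j (c \<odot>\<^bsub>B\<^esub> \<one>\<^bsub>B\<^esub>) = ?g 0 (c \<odot>\<^bsub>B\<^esub> \<one>\<^bsub>B\<^esub>)" if "c \<in> carrier R" for j c
    by (rule place_scalar) (use that i in auto)
  obtain h where h: "h \<in> ring_hom T1 T" and h_p: "\<And>j b. \<lbrakk>j \<le> 1; b \<in> carrier B\<rbrakk> \<Longrightarrow> h (D.p j b) = ?g j b"
    using tensor_ring_universal[where g = ?g and n = 1, OF T.is_cring hom agree] by metis
  note h_closed = ring_hom_closed[OF h] and m_closed = ring_hom_closed[OF mult_map_hom]
  interpret J: ideal "J 0 i" T using i by (simp add: J_ideal)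
  have diff: "h X \<ominus>\<^bsub>T\<^esub> p 0 (m X) \<in> J 0 i" if "X \<in> carrier T1" for X
    using that
  proof (induction X rule: tensor_square_induct)
    case (prod a b)
    have "x \<otimes>\<^bsub>T\<^esub> y \<ominus>\<^bsub>T\<^esub> x \<otimes>\<^bsub>T\<^esub> z = x \<otimes>\<^bsub>T\<^esub> (y \<ominus>\<^bsub>T\<^esub> z)"
      if "x \<in> carrier T" "y \<in> carrier T" "z \<in> carrier T" for x y z
      using that by algebra
    then have "h (D.p 0 a \<otimes>\<^bsub>T1\<^esub> D.p 1 b) \<ominus>\<^bsub>T\<^esub> p 0 (m (D.p 0 a \<otimes>\<^bsub>T1\<^esub> D.p 1 b)) = p 0 a \<otimes>\<^bsub>T\<^esub> d 0 i b"
      using prod i by (simp add: ring_hom_mult[OF mult_map_hom] mult_map_place ring_hom_mult[OF h] h_p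
          ring_hom_mult[OF place_ring_hom] dtensor_def)
    then show ?case using prod i by (simp add: J.I_l_closed d_in_J)
  next
    case (add X Y)
    have "(x \<oplus>\<^bsub>T\<^esub> y) \<ominus>\<^bsub>T\<^esub> (x' \<oplus>\<^bsub>T\<^esub> y') = (x \<ominus>\<^bsub>T\<^esub> x') \<oplus>\<^bsub>T\<^esub> (y \<ominus>\<^bsub>T\<^esub> y')"
      if "x \<in> carrier T" "y \<in> carrier T" "x' \<in> carrier T" "y' \<in> carrier T" for x y x' y'
      using that by algebra
    then have "h (X \<oplus>\<^bsub>T1\<^esub> Y) \<ominus>\<^bsub>T\<^esub> p 0 (m (X \<oplus>\<^bsub>T1\<^esub> Y)) =
        (h X \<ominus>\<^bsub>T\<^esub> p 0 (m X)) \<oplus>\<^bsub>T\<^esub> (h Y \<ominus>\<^bsub>T\<^esub> p 0 (m Y))"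
      using add m_closed h_closed
      by (simp add: ring_hom_add[OF mult_map_hom] ring_hom_add[OF place_ring_hom] ring_hom_add[OF h])
    then show ?case using add by simp
  qed
  have h_diag: "h x \<in> J 0 i" if "x \<in> I1" for x
  proof -
    have "p 0 (m x) = \<zero>\<^bsub>T\<^esub>"
      using that ring_hom_zero[OF place_ring_hom[of 0 n] B_ring T.ring_axioms]
      by (simp add: diag_ideal_iff)
    then show ?thesis using diff[OF I1.Icarr[OF that]] h_closed[OF I1.Icarr[OF that]] by (simp add: T.minus_eq)
  qed
  have h_sq: "h x \<in> JJ" if "x \<in> I2" for x
    using that unfolding diag_ideal_sq_def
  proof induction
    case (prod x y)
    then show ?case
      using prod_in_JJ[OF le0 i h_diag h_diag] I1.Icarr by (simp add: ring_hom_mult[OF h])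
  next
    case (sum x y)
    then have "x \<in> carrier T1" "y \<in> carrier T1" using I2.Icarr unfolding diag_ideal_sq_def by auto
    then show ?case using sum by (simp add: ring_hom_add[OF h])
  qed
  have qh: "(\<lambda>x. JJ +>\<^bsub>T\<^esub> h x) \<in> ring_hom T1 (T Quot JJ)"
    using ring_hom_trans[OF h JJ.rcos_ring_hom] by (simp add: comp_def)
  have ker: "JJ +>\<^bsub>T\<^esub> h x = \<zero>\<^bsub>T Quot JJ\<^esub>" if "x \<in> I2" for x
    using T.a_coset_join2[OF h_closed[OF I2.Icarr[OF that]] JJ.a_subgroup h_sq[OF that]]
    by (simp add: FactRing_def)
  obtain k where k: "k \<in> ring_hom (T1 Quot I2) (T Quot JJ)"
    and k_coset: "\<And>x. x \<in> carrier T1 \<Longrightarrow> k (I2 +>\<^bsub>T1\<^esub> x) = JJ +>\<^bsub>T\<^esub> h x"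
    using ring_hom_quot_lift[OF D.T.ring_axioms JJ.quotient_is_ring qh diag_ideal_sq_ideal ker] by metis
  have "linear_map B \<Omega> (tensor_quot R B n) k"
    unfolding linear_map_def Omega_carrier
  proof (intro conjI ballI funcsetI; elim imageE)
    fix w x assume "w = I2 +>\<^bsub>T1\<^esub> x" "x \<in> I1"
    then show "k w \<in> carrier (tensor_quot R B n)"
      using I1.Icarr h_closed by (simp add: k_coset tensor_quot_ops)
  next
    fix v w x y assume "v = I2 +>\<^bsub>T1\<^esub> x" "x \<in> I1" "w = I2 +>\<^bsub>T1\<^esub> y" "y \<in> I1"
    then show "k (v \<oplus>\<^bsub>\<Omega>\<^esub> w) = k v \<oplus>\<^bsub>tensor_quot R B n\<^esub> k w"
      using I1.Icarr h_closed by (simp add: k_coset tensor_quot_ops Omega_add ring_hom_add[OF h])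
  next
    fix b w x assume "b \<in> carrier B" "w = I2 +>\<^bsub>T1\<^esub> x" "x \<in> I1"
    then show "k (b \<odot>\<^bsub>\<Omega>\<^esub> w) = b \<odot>\<^bsub>tensor_quot R B n\<^esub> k w"
      using I1.Icarr h_closed by (simp add: k_coset tensor_quot_ops Omega_smult ring_hom_mult[OF h] h_p)
  qed
  moreover have "k (univ_deriv R B b) = JJ +>\<^bsub>T\<^esub> d 0 i b" if b: "b \<in> carrier B" for b
    using b I1.Icarr[OF deriv_in_diag_ideal[OF b]]
    by (simp add: univ_deriv_eq k_coset)
      (simp add: dtensor_def ring_hom_minus[OF D.T.ring_axioms T.ring_axioms h] h_p)
  ultimately show ?thesis using that by blast
qed

end

section \<open>The map \<open>\<lambda>\<close> and its image\<close>

context tensor_differentials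
begin

abbreviation "\<Omega>n \<equiv> Omega_power R B n"
abbreviation "TQ \<equiv> tensor_quot R B n"
abbreviation "derivs b \<equiv> (\<lambda>i\<in>{1..n}. univ_deriv R B (b i))"

lemma Omega_power_module: "module B \<Omega>n"
  by (rule module.tensor_power_module[OF Omega_module])

lemma TQ_module: "module B TQ"
  by (rule algebra.module[OF tensor_quot_algebra])

text \<open>The tensors \<open>db\<^sub>1 \<otimes> \<dots> \<otimes> db\<^sub>n\<close> generate the tensor power over \<open>B\<close>.\<close>

lemma Omega_power_induct [consumes 1, case_names derivs smult add]:
  assumes X: "X \<in> carrier \<Omega>n"
    and derivs: "\<And>b. b \<in> {1..n} \<rightarrow> carrier B \<Longrightarrow> P (pure_tensor B \<Omega> {1..n} (derivs b))"
    and smult: "\<And>c X. \<lbrakk>c \<in> carrier B; X \<in> carrier \<Omega>n; P X\<rbrakk> \<Longrightarrow> P (c \<odot>\<^bsub>\<Omega>n\<^esub> X)"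
    and add: "\<And>X Y. \<lbrakk>X \<in> carrier \<Omega>n; Y \<in> carrier \<Omega>n; P X; P Y\<rbrakk> \<Longrightarrow> P (X \<oplus>\<^bsub>\<Omega>n\<^esub> Y)"
  shows "P X"
proof -
  interpret \<Omega>: module B \<Omega> by (rule Omega_module)
  interpret \<Omega>n: module B \<Omega>n by (rule Omega_power_module)
  let ?p = "pure_tensor B \<Omega> {1..n}"
  note ml = \<Omega>.pure_tensor_multilinear[of "{1..n}"]
  have p_in: "?p x \<in> carrier \<Omega>n" if "x \<in> {1..n} \<rightarrow>\<^sub>E carrier \<Omega>" for x
    using multilinear_funcset[OF ml] that by blast
  have p_add: "?p (x(i := v \<oplus>\<^bsub>\<Omega>\<^esub> w)) = ?p (x(i := v)) \<oplus>\<^bsub>\<Omega>n\<^esub> ?p (x(i := w))"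
    if "x \<in> {1..n} \<rightarrow>\<^sub>E carrier \<Omega>" "i \<in> {1..n}" "v \<in> carrier \<Omega>" "w \<in> carrier \<Omega>" for x i v w
    using ml that unfolding multilinear_def by blast
  have p_smult: "?p (x(i := c \<odot>\<^bsub>\<Omega>\<^esub> v)) = c \<odot>\<^bsub>\<Omega>n\<^esub> ?p (x(i := v))"
    if "x \<in> {1..n} \<rightarrow>\<^sub>E carrier \<Omega>" "i \<in> {1..n}" "v \<in> carrier \<Omega>" "c \<in> carrier B" for x i v c
    using ml that unfolding multilinear_def by blast
  \<comment> \<open>induction on the set \<open>S\<close> of indices at which the entry need not be of the form \<open>db\<close>\<close>
  have pure: "P (?p x)"
    if "finite S" "S \<subseteq> {1..n}" "x \<in> {1..n} \<rightarrow>\<^sub>E carrier \<Omega>"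
      "\<And>i. i \<in> {1..n} - S \<Longrightarrow> x i \<in> univ_deriv R B ` carrier B" for S x
    using that
  proof (induction S arbitrary: x rule: finite_induct)
    case empty
    then have "\<forall>i\<in>{1..n}. \<exists>b. b \<in> carrier B \<and> x i = univ_deriv R B b" by blast
    then obtain b where b: "\<forall>i\<in>{1..n}. b i \<in> carrier B \<and> x i = univ_deriv R B (b i)"
      unfolding bchoice_iff by blast
    then have "x = derivs b" using empty.prems(2) by (auto simp: fun_eq_iff PiE_iff extensional_def)
    moreover have "b \<in> {1..n} \<rightarrow> carrier B" using b by blast
    ultimately show ?case using derivs by blast
  next
    case (insert k S)
    have k: "k \<in> {1..n}" and S: "S \<subseteq> {1..n}" using insert.prems(1) by auto
    note x = insert.prems(2)
    have upd: "P (?p (x(k := w)))" if "w \<in> carrier \<Omega>" for w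
      using that
    proof (induction w rule: Omega_induct)
      case (deriv b)
      show ?case
      proof (rule insert.IH[OF S PiE_upd[OF x k univ_deriv_closed[OF deriv]]])
        show "(x(k := univ_deriv R B b)) i \<in> univ_deriv R B ` carrier B" if "i \<in> {1..n} - S" for i
          using insert.prems(3)[of i] that deriv by (cases "i = k") auto
      qed
    next
      case (smult c v)
      show ?case
        unfolding p_smult[OF x k smult(2,1)]
        by (rule assms(3)[OF smult(1) p_in[OF PiE_upd[OF x k smult(2)]] smult(3)])
    next
      case (add v w)
      show ?case
        unfolding p_add[OF x k add(1,2)]
        by (rule assms(4)[OF p_in[OF PiE_upd[OF x k add(1)]] p_in[OF PiE_upd[OF x k add(2)]] add(3,4)])
    qed
    have "x k \<in> carrier \<Omega>" using x k by auto
    then have "P (?p (x(k := x k)))" by (rule upd)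
    then show ?case by simp
  qed
  have pure': "P (?p x)" if "x \<in> {1..n} \<rightarrow>\<^sub>E carrier \<Omega>" for x
    by (rule pure[of "{1..n}"]) (use that in auto)
  show ?thesis
    using X
  proof (induction X rule: \<Omega>.tensor_power_induct)
    case zero
    let ?x = "\<lambda>i\<in>{1..n}. \<zero>\<^bsub>\<Omega>\<^esub>"
    have x: "?x \<in> {1..n} \<rightarrow>\<^sub>E carrier \<Omega>" by auto
    have "P (\<zero>\<^bsub>B\<^esub> \<odot>\<^bsub>\<Omega>n\<^esub> ?p ?x)" by (rule smult[OF _ p_in[OF x] pure'[OF x]]) simp
    then show ?case using p_in[OF x] by simp
  next
    case (smult_pure a x)
    then show ?case using smult p_in pure' by blast
  next
    case (add X Y)
    then show ?case using assms(4) by blast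
  qed
qed

lemma is_lambdaD:
  assumes "is_lambda R B n l"
  shows "l \<in> extensional (carrier \<Omega>n)" and "linear_map B \<Omega>n TQ l"
    and "b \<in> {1..n} \<rightarrow> carrier B \<Longrightarrow>
      l (pure_tensor B \<Omega> {1..n} (derivs b)) = JJ +>\<^bsub>T\<^esub> (\<Otimes>\<^bsub>T\<^esub>i\<in>{1..n}. d 0 i (b i))"
  using assms unfolding is_lambda_def by blast+

lemma lambda_unique:
  assumes "is_lambda R B n l" "is_lambda R B n l'"
  shows "l = l'"
proof (rule extensionalityI[OF is_lambdaD(1)[OF assms(1)] is_lambdaD(1)[OF assms(2)]])
  note lin = linear_mapD[OF is_lambdaD(2)[OF assms(1)]] linear_mapD[OF is_lambdaD(2)[OF assms(2)]]
  fix X assume "X \<in> carrier \<Omega>n"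
  then show "l X = l' X"
  proof (induction X rule: Omega_power_induct)
    case (derivs b)
    then show ?case using is_lambdaD(3)[OF assms(1)] is_lambdaD(3)[OF assms(2)] by simp
  next
    case (smult c X)
    then show ?case using lin by simp
  next
    case (add X Y)
    then show ?case using lin by simp
  qed
qed

lemma tensor_quot_finprod:
  assumes "f \<in> I \<rightarrow> carrier T"
  shows "(\<Otimes>\<^bsub>TQ\<^esub>i\<in>I. JJ +>\<^bsub>T\<^esub> f i) = JJ +>\<^bsub>T\<^esub> (\<Otimes>\<^bsub>T\<^esub>i\<in>I. f i)"
  unfolding tensor_quot_def restrict_scalars_finprod
  by (rule ring_hom_finprod[OF T.is_cring JJ.quotient_is_cring[OF T.is_cring] JJ.rcos_ring_hom assms, symmetric])

lemma lambda_exists: "\<exists>l. is_lambda R B n l"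
proof -
  interpret \<Omega>: module B \<Omega> by (rule Omega_module)
  interpret \<Omega>n: module B \<Omega>n by (rule Omega_power_module)
  interpret TQ: algebra B TQ by (rule tensor_quot_algebra)
  have "\<forall>i\<in>{1..n}. \<exists>k. linear_map B \<Omega> TQ k \<and> (\<forall>b\<in>carrier B. k (univ_deriv R B b) = JJ +>\<^bsub>T\<^esub> d 0 i b)"
  proof
    fix i assume "i \<in> {1..n}"
    then have "i \<le> n" by simp
    then show "\<exists>k. linear_map B \<Omega> TQ k \<and> (\<forall>b\<in>carrier B. k (univ_deriv R B b) = JJ +>\<^bsub>T\<^esub> d 0 i b)"
      by (rule Omega_to_quot) blast
  qed
  then obtain \<mu> where \<mu>: "\<And>i. i \<in> {1..n} \<Longrightarrow> linear_map B \<Omega> TQ (\<mu> i)"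
    and \<mu>_deriv: "\<And>i b. \<lbrakk>i \<in> {1..n}; b \<in> carrier B\<rbrakk> \<Longrightarrow> \<mu> i (univ_deriv R B b) = JJ +>\<^bsub>T\<^esub> d 0 i b"
    unfolding bchoice_iff by blast
  define \<phi> where "\<phi> x = (\<Otimes>\<^bsub>TQ\<^esub>i\<in>{1..n}. \<mu> i (x i))" for x
  have ml: "multilinear B \<Omega> TQ {1..n} \<phi>"
    by (rule multilinear_prod[OF tensor_quot_algebra _ \<mu> Omega_module]) (simp_all add: \<phi>_def)
  define l where "l = restrict (tensor_lift B TQ \<phi>) (carrier \<Omega>n)"
  note lin = linear_mapD[OF \<Omega>.tensor_lift_linear[OF TQ_module ml]]
  have "is_lambda R B n l"
    unfolding is_lambda_def
  proof (intro conjI ballI)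
    show "l \<in> extensional (carrier \<Omega>n)" by (simp add: l_def)
    show "linear_map B \<Omega>n TQ l"
      unfolding linear_map_def l_def using lin by simp
    fix b assume b: "b \<in> {1..n} \<rightarrow> carrier B"
    have x: "derivs b \<in> {1..n} \<rightarrow>\<^sub>E carrier \<Omega>" using b univ_deriv_closed by auto
    have "pure_tensor B \<Omega> {1..n} (derivs b) \<in> carrier \<Omega>n"
      using multilinear_funcset[OF \<Omega>.pure_tensor_multilinear] x by blast
    then have "l (pure_tensor B \<Omega> {1..n} (derivs b)) = \<phi> (derivs b)"
      by (simp add: l_def \<Omega>.tensor_lift_pure[OF TQ_module ml x])
    also have "\<dots> = (\<Otimes>\<^bsub>TQ\<^esub>i\<in>{1..n}. JJ +>\<^bsub>T\<^esub> d 0 i (b i))"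
      unfolding \<phi>_def by (rule TQ.finprod_cong') (use b in \<open>auto simp: \<mu>_deriv tensor_quot_ops Pi_iff\<close>)
    also have "\<dots> = JJ +>\<^bsub>T\<^esub> (\<Otimes>\<^bsub>T\<^esub>i\<in>{1..n}. d 0 i (b i))"
      by (rule tensor_quot_finprod) (use b in \<open>auto simp: Pi_iff\<close>)
    finally show "l (pure_tensor B \<Omega> {1..n} (derivs b)) = JJ +>\<^bsub>T\<^esub> (\<Otimes>\<^bsub>T\<^esub>i\<in>{1..n}. d 0 i (b i))" .
  qed
  then show ?thesis by blast
qed

text \<open>For \<open>r = 0\<close> the factor with index \<open>s\<close> lies in \<open>J 0 s\<close>. For \<open>r > 0\<close> the identity
  \<open>d 0 s b = d 0 r b + d r s b\<close> is used: multiplied by the factor with index \<open>r\<close>, the first summand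
  contributes an element of the square of \<open>J 0 r\<close> and the second one an element of \<open>J r s\<close>.\<close>

lemma prod_in_J_plus_JJ:
  assumes b: "b \<in> {1..n} \<rightarrow> carrier B" and rs: "r < s" "s \<le> n"
  shows "JJ +>\<^bsub>T\<^esub> (\<Otimes>\<^bsub>T\<^esub>i\<in>{1..n}. d 0 i (b i)) \<in> Jtilde R B n r s"
proof -
  have di: "d 0 i (b i) \<in> carrier T" if "i \<in> {1..n}" for i using b that by (auto simp: Pi_iff)
  have s: "s \<in> {1..n}" and rn: "r \<le> n" using rs by auto
  let ?P = "\<Otimes>\<^bsub>T\<^esub>i\<in>{1..n} - {s}. d 0 i (b i)"
  have P: "?P \<in> carrier T" by (rule T.finprod_closed) (use di in auto)
  have "{1..n} = insert s ({1..n} - {s})" using s by auto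
  then have split: "(\<Otimes>\<^bsub>T\<^esub>i\<in>{1..n}. d 0 i (b i)) = d 0 s (b s) \<otimes>\<^bsub>T\<^esub> ?P"
    using T.finprod_insert[of "{1..n} - {s}" s "\<lambda>i. d 0 i (b i)"] di s by auto
  show ?thesis
  proof (cases "r = 0")
    case True
    have "d 0 s (b s) \<otimes>\<^bsub>T\<^esub> ?P \<in> J 0 s"
      using ideal.I_r_closed[OF J_ideal[of 0 s] d_in_J[of 0 s "b s"] P] b s rs by (auto simp: Pi_iff)
    then show ?thesis unfolding Jtilde_def split using True by blast
  next
    case False
    then have r: "r \<in> {1..n} - {s}" using rs by auto
    let ?Q = "\<Otimes>\<^bsub>T\<^esub>i\<in>{1..n} - {s} - {r}. d 0 i (b i)"
    have Q: "?Q \<in> carrier T" by (rule T.finprod_closed) (use di in auto)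
    have "{1..n} - {s} = insert r ({1..n} - {s} - {r})" using r by auto
    then have split_r: "?P = d 0 r (b r) \<otimes>\<^bsub>T\<^esub> ?Q"
      using T.finprod_insert[of "{1..n} - {s} - {r}" r "\<lambda>i. d 0 i (b i)"] di r by auto
    have br: "b r \<in> carrier B" and bs: "b s \<in> carrier B" using b r s by auto
    let ?u = "d 0 r (b s)" and ?v = "d r s (b s)" and ?w = "d 0 r (b r)"
    have closed: "?u \<in> carrier T" "?v \<in> carrier T" "?w \<in> carrier T" using rs rn br bs by auto
    have uw: "?u \<otimes>\<^bsub>T\<^esub> ?w \<otimes>\<^bsub>T\<^esub> ?Q \<in> JJ"
      by (rule JJ.I_r_closed[OF prod_in_JJ[of 0 r] Q]) (use rn br bs d_in_J[of 0 r] in auto)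
    have v: "?v \<otimes>\<^bsub>T\<^esub> ?P \<in> J r s"
      by (rule ideal.I_r_closed[OF J_ideal d_in_J P]) (use rs rn bs in auto)
    have expand: "(u \<oplus>\<^bsub>T\<^esub> v) \<otimes>\<^bsub>T\<^esub> (w \<otimes>\<^bsub>T\<^esub> q) = u \<otimes>\<^bsub>T\<^esub> w \<otimes>\<^bsub>T\<^esub> q \<oplus>\<^bsub>T\<^esub> v \<otimes>\<^bsub>T\<^esub> (w \<otimes>\<^bsub>T\<^esub> q)"
      if "u \<in> carrier T" "v \<in> carrier T" "w \<in> carrier T" "q \<in> carrier T" for u v w q
      using that by algebra
    have "d 0 s (b s) = ?u \<oplus>\<^bsub>T\<^esub> ?v" by (rule d_trans) (use rs rn bs in auto)
    then have "d 0 s (b s) \<otimes>\<^bsub>T\<^esub> ?P = ?u \<otimes>\<^bsub>T\<^esub> ?w \<otimes>\<^bsub>T\<^esub> ?Q \<oplus>\<^bsub>T\<^esub> ?v \<otimes>\<^bsub>T\<^esub> ?P"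
      unfolding split_r using expand[OF closed Q] by simp
    moreover have "JJ +>\<^bsub>T\<^esub> (x \<oplus>\<^bsub>T\<^esub> y) = JJ +>\<^bsub>T\<^esub> y" if "x \<in> JJ" "y \<in> carrier T" for x y
      using JJ.a_repr_independence'[of "x \<oplus>\<^bsub>T\<^esub> y" y] that by (auto simp: a_r_coset_def r_coset_def)
    ultimately show ?thesis
      unfolding split Jtilde_def using uw v J_carrier[OF rn rs(2) v] by auto
  qed
qed

lemma lambda_in_Jtilde:
  assumes l: "is_lambda R B n l" and X: "X \<in> carrier \<Omega>n" and rs: "r < s" "s \<le> n"
  shows "l X \<in> Jtilde R B n r s"
proof -
  note lin = linear_mapD[OF is_lambdaD(2)[OF l]]
  have J: "ideal (J r s) T" using rs by (intro J_ideal) auto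
  interpret J: ideal "J r s" T by (rule J)
  show ?thesis
    using X
  proof (induction X rule: Omega_power_induct)
    case (derivs b)
    then show ?case using is_lambdaD(3)[OF l] prod_in_J_plus_JJ rs by simp
  next
    case (smult c X)
    then obtain x where x: "x \<in> J r s" "l X = JJ +>\<^bsub>T\<^esub> x" by (auto simp: Jtilde_def)
    then have "l (c \<odot>\<^bsub>\<Omega>n\<^esub> X) = JJ +>\<^bsub>T\<^esub> (p 0 c \<otimes>\<^bsub>T\<^esub> x)"
      using smult lin J.Icarr by (simp add: tensor_quot_ops)
    moreover have "p 0 c \<otimes>\<^bsub>T\<^esub> x \<in> J r s" using x smult by (intro J.I_l_closed) auto
    ultimately show ?case by (auto simp: Jtilde_def)
  next
    case (add X Y)
    then obtain x y where "x \<in> J r s" "l X = JJ +>\<^bsub>T\<^esub> x" "y \<in> J r s" "l Y = JJ +>\<^bsub>T\<^esub> y"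
      by (auto simp: Jtilde_def)
    then have "l (X \<oplus>\<^bsub>\<Omega>n\<^esub> Y) = JJ +>\<^bsub>T\<^esub> (x \<oplus>\<^bsub>T\<^esub> y)" "x \<oplus>\<^bsub>T\<^esub> y \<in> J r s"
      using add lin J.Icarr by (simp_all add: tensor_quot_ops)
    then show ?case by (auto simp: Jtilde_def)
  qed
qed

lemma reduce_in_lambda_image:
  assumes l: "is_lambda R B n l" and x: "x \<in> carrier T"
  shows "JJ +>\<^bsub>T\<^esub> reduce n x \<in> l ` carrier \<Omega>n"
proof -
  interpret \<Omega>: module B \<Omega> by (rule Omega_module)
  interpret \<Omega>n: module B \<Omega>n by (rule Omega_power_module)
  note lin = linear_mapD[OF is_lambdaD(2)[OF l]]
  show ?thesis
    using x
  proof (induction x rule: tensor_ring_induct)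
    case (pure b)
    let ?D = "pure_tensor B \<Omega> {1..n} (derivs b)" and ?P = "\<Otimes>\<^bsub>T\<^esub>i\<in>{1..n}. d 0 i (b i)"
    have b: "b \<in> {..n} \<rightarrow> carrier B" "b \<in> {1..n} \<rightarrow> carrier B" "b 0 \<in> carrier B" using pure by auto
    have P: "?P \<in> carrier T" by (rule T.finprod_closed) (use b in \<open>auto simp: Pi_iff\<close>)
    have "derivs b \<in> {1..n} \<rightarrow>\<^sub>E carrier \<Omega>" using b univ_deriv_closed by auto
    then have D: "?D \<in> carrier \<Omega>n"
      using multilinear_funcset[OF \<Omega>.pure_tensor_multilinear] by blast
    have "(\<Otimes>\<^bsub>T\<^esub>i\<in>{1..n}. if i \<le> n then d 0 i (b i) else p i (b i)) = ?P"
      by (rule T.finprod_cong') (use b in \<open>auto simp: Pi_iff\<close>)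
    then have "reduce n (pure_tensor R B {..n} b) = p 0 (b 0) \<otimes>\<^bsub>T\<^esub> ?P"
      unfolding pure_tensor_eq_prod[OF pure] using reduce_pure[OF b(1) order_refl] by simp
    then have "JJ +>\<^bsub>T\<^esub> reduce n (pure_tensor R B {..n} b) = l (b 0 \<odot>\<^bsub>\<Omega>n\<^esub> ?D)"
      using lin(3)[OF b(3) D] is_lambdaD(3)[OF l b(2)] tensor_quot_ops(3)[OF b(3) P] by simp
    then show ?case using b(3) D by simp
  next
    case (add x y)
    then obtain X Y where XY: "X \<in> carrier \<Omega>n" "JJ +>\<^bsub>T\<^esub> reduce n x = l X"
      "Y \<in> carrier \<Omega>n" "JJ +>\<^bsub>T\<^esub> reduce n y = l Y" by auto
    then have "JJ +>\<^bsub>T\<^esub> reduce n (x \<oplus>\<^bsub>T\<^esub> y) = l (X \<oplus>\<^bsub>\<Omega>n\<^esub> Y)"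
      using add lin tensor_quot_ops(2)[of "reduce n x" "reduce n y"] by (simp add: reduce_add)
    then show ?case using XY by simp
  qed
qed

text \<open>Membership in the images of \<open>J 0 1, \<dots>, J 0 n\<close> suffices: it says that every \<open>collapse i\<close> takes \<open>x\<close> into
  \<open>JJ\<close>, so \<open>x\<close> is congruent to \<open>reduce n x\<close>.\<close>

lemma Jtilde_inter_subset:
  assumes l: "is_lambda R B n l" and x: "x \<in> carrier T"
    and mem: "\<And>i. i \<in> {1..n} \<Longrightarrow> JJ +>\<^bsub>T\<^esub> x \<in> Jtilde R B n 0 i"
  shows "JJ +>\<^bsub>T\<^esub> x \<in> l ` carrier \<Omega>n"
proof -
  have "collapse i x \<in> JJ" if i: "i \<in> {1..n}" for i
  proof -
    obtain y where y: "y \<in> J 0 i" "JJ +>\<^bsub>T\<^esub> x = JJ +>\<^bsub>T\<^esub> y"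
      using mem[OF i] by (auto simp: Jtilde_def)
    have yT: "y \<in> carrier T" using J_carrier y(1) i by auto
    have "x \<ominus>\<^bsub>T\<^esub> y \<in> JJ"
      using T.quotient_eq_iff_same_a_r_cos[OF JJ_ideal x yT] y(2) by simp
    then have "collapse i (x \<ominus>\<^bsub>T\<^esub> y) \<in> JJ" by (rule collapse_JJ)
    moreover have "collapse i y = \<zero>\<^bsub>T\<^esub>" using collapse_J0 y(1) i by simp
    ultimately show ?thesis
      using x yT ring_hom_closed[OF collapse_hom x]
      by (simp add: ring_hom_minus[OF T.ring_axioms T.ring_axioms collapse_hom])
        (simp add: T.minus_eq)
  qed
  then have "x \<ominus>\<^bsub>T\<^esub> reduce n x \<in> JJ" by (rule reduce_congruent[OF x])
  then have "JJ +>\<^bsub>T\<^esub> x = JJ +>\<^bsub>T\<^esub> reduce n x"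
    using T.quotient_eq_iff_same_a_r_cos[OF JJ_ideal x reduce_closed[OF x]] by simp
  then show ?thesis using reduce_in_lambda_image[OF l x] by simp
qed

end

theorem proposition1p6:
  fixes R :: "('r, 's) ring_scheme" and B :: "('r, 'b, 't) module_scheme" and n :: nat
  assumes "algebra R B" and "n \<ge> 1"
  shows "(\<exists>!l. is_lambda R B n l) \<and>
    (\<forall>l. is_lambda R B n l \<longrightarrow>
      l ` carrier (Omega_power R B n) = (\<Inter>(r, s)\<in>{(r, s). r < s \<and> s \<le> n}. Jtilde R B n r s))"
proof -
  interpret tensor_differentials R B n
    by (rule tensor_differentials.intro[OF assms(1)])
  have "l ` carrier (Omega_power R B n) = (\<Inter>(r, s)\<in>{(r, s). r < s \<and> s \<le> n}. Jtilde R B n r s)"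
    if l: "is_lambda R B n l" for l
  proof (intro equalityI subsetI)
    fix Z assume "Z \<in> l ` carrier (Omega_power R B n)"
    then show "Z \<in> (\<Inter>(r, s)\<in>{(r, s). r < s \<and> s \<le> n}. Jtilde R B n r s)"
      using lambda_in_Jtilde[OF l] by auto
  next
    fix Z assume Z: "Z \<in> (\<Inter>(r, s)\<in>{(r, s). r < s \<and> s \<le> n}. Jtilde R B n r s)"
    then have mem: "Z \<in> Jtilde R B n 0 i" if "i \<in> {1..n}" for i
      using that by auto
    \<comment> \<open>as \<open>n \<ge> 1\<close>, the pair \<open>(0, 1)\<close> occurs in the intersection, so \<open>Z\<close> is a coset\<close>
    have "Z \<in> Jtilde R B n 0 1" by (rule mem) (use assms(2) in simp)
    then obtain x where x: "x \<in> J 0 1" "Z = JJ +>\<^bsub>T\<^esub> x"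
      by (auto simp: Jtilde_def)
    then show "Z \<in> l ` carrier (Omega_power R B n)"
      using Jtilde_inter_subset[OF l J_carrier[OF _ assms(2) x(1)]] mem by simp
  qed
  then show ?thesis using lambda_exists lambda_unique by blast
qed

end
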